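(* Let $X$ be a locally compact Hausdorff space, let $\phi:X\to X$ be a continuous proper surjection, and let $\{X_n\}_{n=0}^\infty$ be a sequence of closed subsets of $X$ such that $X_{n+1}\cup\phi(X_{n+1})\subseteq X_n$ for all $n\in\mathbb Z_+$. Let $\mathcal I\sim\{X_n\}_{n=0}^\infty$ be the associated ideal of the semicrossed product $C_0(X)\times_\phi\mathbb Z_+$, that is, $\mathcal I=\{A\in C_0(X)\times_\phi\mathbb Z_+ : E_n(A)(X_n)=\{0\}\text{ for all } n\in\mathbb Z_+\}$, and suppose $\mathcal I$ is non-zero. The following are equivalent: (1) $\mathcal I$ has a left approximate unit. (2) $X_0\subsetneq X$ and $\phi^n(X\setminus X_n)=X\setminus X_0$ for all $n\in\mathbb Z_+$. (3) $\phi(X\setminus X_1)=X\setminus X_0$ and $\phi(X_{n+1}\setminus X_{n+2})=X_n\setminus X_{n+1}$ for all $n\in\mathbb Z_+$.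
   Context: $\mathbb Z_+=\{0,1,2,\dots\}$. A map $\phi:X\to X$ is proper if $\phi^{-1}(K)$ is compact for every compact $K\subseteq X$. For $f\in C_0(X)$ and $n\in\mathbb Z_+$ put $\alpha^n(f)=\alpha_n(f)=f\circ\phi^n$. Semicrossed product: $\ell^1(\mathbb Z_+,C_0(X))$ is the Banach space of formal series $A=\sum_{n\in\mathbb Z_+}U^nf_n$, $f_n\in C_0(X)$, with norm $\|A\|_1=\sum_n\|f_n\|_{C_0(X)}<\infty$; it is a Banach algebra under the multiplication $(U^nf)(U^mg)=U^{n+m}(\alpha^m(f)g)$, extended by linearity and continuity. Let $C_0(X)$ act faithfully on a Hilbert space $\mathcal H_0$. Define a faithful contractive representation $\pi$ of $\ell^1(\mathbb Z_+,C_0(X))$ on $\mathcal H=\mathcal H_0\otimes\ell^2(\mathbb Z_+)$ by $\pi(U^nf)(\xi\otimes e_k)=\alpha^k(f)\xi\otimes e_{k+n}$. The semicrossed product $C_0(X)\times_\phi\mathbb Z_+$ is the norm closure of the image of $\pi$ in $\mathcal B(\mathcal H)$; $\pi(U^nf)$ is written $U^nf$. Fourier coefficients: the maps $E_n:\ell^1(\mathbb Z_+,C_0(X))\to C_0(X)$, $E_n(\sum_m U^mf_m)=f_n$, are contractive for the operator norm and hence extend to contractions $E_n:C_0(X)\times_\phi\mathbb Z_+\to C_0(X)$. Approximate units: a left (resp. right) approximate unit of a Banach algebra $\mathcal A$ is a net $\{u_\lambda\}_{\lambda\in\Lambda}$ in $\mathcal A$ such that, for some $r>0$, $\|u_\lambda\|\le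 r$ for all $\lambda\in\Lambda$, and $\lim_\lambda u_\lambda a=a$ (resp. $\lim_\lambda au_\lambda=a$) in norm for all $a\in\mathcal A$. An ideal $\mathcal I$ of a Banach algebra has a left (resp. right) approximate unit if it has one as an algebra (in particular the net lies in $\mathcal I$). *)

theory Defs
  imports "HOL-Analysis.Analysis"
begin

text \<open>The inner product is linear in its first argument. Positive definiteness is
  contained in the axiom relating it to the norm.\<close>

class chilbert_space = banach +
  fixes scaleC :: "complex \<Rightarrow> 'a \<Rightarrow> 'a" (infixr \<open>*\<^sub>C\<close> 75)
    and cinner :: "'a \<Rightarrow> 'a \<Rightarrow> complex"
  assumes scaleC_add_right: "c *\<^sub>C (x + y) = c *\<^sub>C x + c *\<^sub>C y"
    and scaleC_add_left: "(c + d) *\<^sub>C x = c *\<^sub>C x + d *\<^sub>C x"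
    and scaleC_scaleC: "c *\<^sub>C d *\<^sub>C x = (c * d) *\<^sub>C x"
    and scaleR_scaleC: "r *\<^sub>R x = complex_of_real r *\<^sub>C x"
    and cinner_add_left: "cinner (x + y) z = cinner x z + cinner y z"
    and cinner_scaleC_left: "cinner (c *\<^sub>C x) y = c * cinner x y"
    and cinner_commute: "cinner x y = cnj (cinner y x)"
    and norm_eq_sqrt_cinner: "norm x = sqrt (Re (cinner x x))"

lemma cinner_self: "cinner x x = complex_of_real ((norm x)\<^sup>2)" for x :: "'a::chilbert_space"
proof -
  have "Im (cinner x x) = 0"
    using cinner_commute[of x x] by (metis cnj.simps(2) equal_neg_zero)
  moreover have "0 \<le> Re (cinner x x)"
    using norm_ge_zero[of x] norm_eq_sqrt_cinner[of x] by simp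
  ultimately show ?thesis
    by (simp add: norm_eq_sqrt_cinner complex_eq_iff)
qed

lemma cinner_add_right: "cinner x (y + z) = cinner x y + cinner x z"
  for x :: "'a::chilbert_space"
  by (metis cinner_add_left cinner_commute complex_cnj_add)

lemma cinner_scaleC_right: "cinner x (c *\<^sub>C y) = cnj c * cinner x y"
  for x :: "'a::chilbert_space"
  by (metis cinner_commute cinner_scaleC_left complex_cnj_mult)

lemma norm_scaleC: "norm (c *\<^sub>C x) = cmod c * norm x" for x :: "'a::chilbert_space"
proof -
  have "complex_of_real ((norm (c *\<^sub>C x))\<^sup>2) = c * cnj c * complex_of_real ((norm x)\<^sup>2)"
    by (metis cinner_self cinner_scaleC_left cinner_scaleC_right mult.assoc)
  also have "\<dots> = complex_of_real ((cmod c * norm x)\<^sup>2)"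
    by (simp only: complex_norm_square[symmetric] power_mult_distrib of_real_mult)
  finally have "(norm (c *\<^sub>C x))\<^sup>2 = (cmod c * norm x)\<^sup>2"
    by (simp only: of_real_eq_iff)
  then show ?thesis
    by simp
qed

lemma norm_cinner_le: "cmod (cinner x y) \<le> ((norm x)\<^sup>2 + (norm y)\<^sup>2) / 2"
  for x :: "'a::chilbert_space"
proof -
  define c where "c = - sgn (cinner x y)"
  have "0 \<le> Re (cinner (x + c *\<^sub>C y) (x + c *\<^sub>C y))"
    by (simp add: cinner_self)
  also have "cinner (x + c *\<^sub>C y) (x + c *\<^sub>C y)
      = cinner x x + cnj c * cinner x y + cnj (cnj c * cinner x y)
        + c * cnj c * cinner y y"
    using cinner_commute[of y x]
    by (simp add: cinner_add_left cinner_add_right cinner_scaleC_left cinner_scaleC_right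
        algebra_simps)
  also have "cnj c * cinner x y = - complex_of_real (cmod (cinner x y))"
    using complex_norm_square[of "cinner x y"]
    by (cases "cinner x y = 0")
      (auto simp: c_def sgn_eq divide_simps power2_eq_square mult.commute)
  also have "c * cnj c * cinner y y = complex_of_real ((cmod c)\<^sup>2 * (norm y)\<^sup>2)"
    unfolding of_real_mult complex_norm_square cinner_self by simp
  finally have "2 * cmod (cinner x y) \<le> (norm x)\<^sup>2 + (cmod c)\<^sup>2 * (norm y)\<^sup>2"
    by (simp add: cinner_self)
  moreover have "(cmod c)\<^sup>2 * (norm y)\<^sup>2 \<le> 1 * (norm y)\<^sup>2"
    by (intro mult_right_mono) (auto simp: c_def norm_sgn)
  ultimately show ?thesis by simp
qed

text \<open>The type \<open>'h ell2\<close> is the Hilbert space tensor product of \<open>'h\<close> with the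
  sequence space over the natural numbers; the elementary tensor of \<open>\<xi>\<close> and the basis
  vector \<open>e\<^sub>k\<close> is the sequence that is \<open>\<xi>\<close> in place \<open>k\<close> and zero elsewhere.\<close>

typedef (overloaded) 'h ell2 = "{x :: nat \<Rightarrow> 'h::chilbert_space. summable (\<lambda>k. (norm (x k))\<^sup>2)}"
  morphisms ell2_nth Abs_ell2
  by (rule exI[of _ "\<lambda>_. 0"]) simp

setup_lifting type_definition_ell2

lemma ell2_summable: "summable (\<lambda>k. (norm (ell2_nth x k))\<^sup>2)"
  using ell2_nth[of x] by simp

lemma ell2_eqI: "(\<And>k. ell2_nth x k = ell2_nth y k) \<Longrightarrow> x = y"
  by (meson ell2_nth_inject ext)

lemma square_summable_add:
  fixes x y :: "nat \<Rightarrow> 'h::real_normed_vector"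
  assumes "summable (\<lambda>k. (norm (x k))\<^sup>2)" "summable (\<lambda>k. (norm (y k))\<^sup>2)"
  shows "summable (\<lambda>k. (norm (x k + y k))\<^sup>2)"
proof (rule summable_comparison_test')
  show "summable (\<lambda>k. 2 * (norm (x k))\<^sup>2 + 2 * (norm (y k))\<^sup>2)"
    using assms by (intro summable_add summable_mult)
  fix k
  have "(norm (x k + y k))\<^sup>2 \<le> (norm (x k) + norm (y k))\<^sup>2"
    by (intro power_mono norm_triangle_ineq) auto
  also have "\<dots> \<le> 2 * (norm (x k))\<^sup>2 + 2 * (norm (y k))\<^sup>2"
    using sum_squares_bound[of "norm (x k)" "norm (y k)"] by (simp add: power2_sum)
  finally show "norm ((norm (x k + y k))\<^sup>2) \<le> 2 * (norm (x k))\<^sup>2 + 2 * (norm (y k))\<^sup>2"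
    by simp
qed

lemma square_summable_scaleC:
  fixes x :: "nat \<Rightarrow> 'h::chilbert_space"
  assumes "summable (\<lambda>k. (norm (x k))\<^sup>2)"
  shows "summable (\<lambda>k. (norm (c *\<^sub>C x k))\<^sup>2)"
  using summable_mult[OF assms, of "(cmod c)\<^sup>2"] by (simp add: norm_scaleC power_mult_distrib)

lemma square_summable_minus:
  fixes x y :: "nat \<Rightarrow> 'h::real_normed_vector"
  assumes "summable (\<lambda>k. (norm (x k))\<^sup>2)" "summable (\<lambda>k. (norm (y k))\<^sup>2)"
  shows "summable (\<lambda>k. (norm (x k - y k))\<^sup>2)"
  using square_summable_add[of x "\<lambda>k. - y k"] assms by simp

lemma L2_set_le_iff: "0 \<le> B \<Longrightarrow> L2_set f A \<le> B \<longleftrightarrow> (\<Sum>i\<in>A. (f i)\<^sup>2) \<le> B\<^sup>2"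
  unfolding L2_set_def by (meson real_le_lsqrt real_sqrt_le_iff sqrt_le_D sum_nonneg zero_le_power2)

lemma suminf_square_le_iff:
  fixes x :: "nat \<Rightarrow> 'h::real_normed_vector"
  assumes "0 \<le> B"
  shows "(summable (\<lambda>k. (norm (x k))\<^sup>2) \<and> sqrt (\<Sum>k. (norm (x k))\<^sup>2) \<le> B)
     \<longleftrightarrow> (\<forall>N. L2_set (\<lambda>k. norm (x k)) {..<N} \<le> B)"
proof safe
  fix N assume s: "summable (\<lambda>k. (norm (x k))\<^sup>2)" and le: "sqrt (\<Sum>k. (norm (x k))\<^sup>2) \<le> B"
  have "(\<Sum>k<N. (norm (x k))\<^sup>2) \<le> (\<Sum>k. (norm (x k))\<^sup>2)"
    by (intro sum_le_suminf s) auto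
  also have "\<dots> \<le> B\<^sup>2" using le by (rule sqrt_le_D)
  finally show "L2_set (\<lambda>k. norm (x k)) {..<N} \<le> B" using assms by (simp add: L2_set_le_iff)
next
  assume "\<forall>N. L2_set (\<lambda>k. norm (x k)) {..<N} \<le> B"
  then have le: "(\<Sum>k<N. (norm (x k))\<^sup>2) \<le> B\<^sup>2" for N
    using assms by (simp add: L2_set_le_iff)
  show s: "summable (\<lambda>k. (norm (x k))\<^sup>2)"
    by (rule summableI_nonneg_bounded[OF _ le]) auto
  then have "(\<Sum>k. (norm (x k))\<^sup>2) \<le> B\<^sup>2" by (intro suminf_le_const le)
  then show "sqrt (\<Sum>k. (norm (x k))\<^sup>2) \<le> B" by (simp add: assms real_le_lsqrt)
qed

instantiation ell2 :: (chilbert_space) real_vector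
begin

lift_definition zero_ell2 :: "'a ell2" is "\<lambda>_. 0" by simp
lift_definition plus_ell2 :: "'a ell2 \<Rightarrow> 'a ell2 \<Rightarrow> 'a ell2" is "\<lambda>x y k. x k + y k"
  by (rule square_summable_add)
lift_definition minus_ell2 :: "'a ell2 \<Rightarrow> 'a ell2 \<Rightarrow> 'a ell2" is "\<lambda>x y k. x k - y k"
  by (rule square_summable_minus)
lift_definition uminus_ell2 :: "'a ell2 \<Rightarrow> 'a ell2" is "\<lambda>x k. - x k" by simp
lift_definition scaleR_ell2 :: "real \<Rightarrow> 'a ell2 \<Rightarrow> 'a ell2" is "\<lambda>r x k. r *\<^sub>R x k"
  unfolding scaleR_scaleC by (rule square_summable_scaleC)

instance
proof
  fix x y z :: "'a ell2" and a b :: real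
  show "x + y + z = x + (y + z)" by transfer (simp add: add.assoc)
  show "x + y = y + x" by transfer (simp add: add.commute)
  show "0 + x = x" "- x + x = 0" "x - y = x + - y" by (transfer; simp)+
  show "a *\<^sub>R (x + y) = a *\<^sub>R x + a *\<^sub>R y" by transfer (simp add: scaleR_add_right)
  show "(a + b) *\<^sub>R x = a *\<^sub>R x + b *\<^sub>R x" by transfer (simp add: scaleR_add_left)
  show "a *\<^sub>R b *\<^sub>R x = (a * b) *\<^sub>R x" "1 *\<^sub>R x = x" by (transfer; simp)+
qed

end

instantiation ell2 :: (chilbert_space) real_normed_vector
begin

lift_definition norm_ell2 :: "'a ell2 \<Rightarrow> real" is "\<lambda>x. sqrt (\<Sum>k. (norm (x k))\<^sup>2)" .

definition sgn_ell2 :: "'a ell2 \<Rightarrow> 'a ell2" where "sgn_ell2 x = x /\<^sub>R norm x"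
definition dist_ell2 :: "'a ell2 \<Rightarrow> 'a ell2 \<Rightarrow> real" where "dist_ell2 x y = norm (x - y)"
definition uniformity_ell2 :: "('a ell2 \<times> 'a ell2) filter" where
  "uniformity_ell2 = (INF e\<in>{0<..}. principal {(x, y). dist x y < e})"
definition open_ell2 :: "'a ell2 set \<Rightarrow> bool" where
  "open_ell2 U = (\<forall>x\<in>U. \<forall>\<^sub>F (x', y) in uniformity. x' = x \<longrightarrow> y \<in> U)"

lemma norm_ell2_le_iff:
  "0 \<le> B \<Longrightarrow> norm x \<le> B \<longleftrightarrow> (\<forall>N. L2_set (\<lambda>k. norm (ell2_nth x k)) {..<N} \<le> B)"
  using suminf_square_le_iff[of B "ell2_nth x"] by (simp add: norm_ell2.rep_eq ell2_summable)

lemma norm_ell2_nonneg: "0 \<le> norm x" for x :: "'a ell2"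
  by (simp add: norm_ell2.rep_eq ell2_summable suminf_nonneg)

lemma L2_set_le_norm_ell2: "L2_set (\<lambda>k. norm (ell2_nth x k)) {..<N} \<le> norm x"
  using norm_ell2_le_iff norm_ell2_nonneg by blast

instance
proof
  fix x y :: "'a ell2" and a :: real
  show "sgn x = x /\<^sub>R norm x" by (rule sgn_ell2_def)
  show "dist x y = norm (x - y)" by (rule dist_ell2_def)
  show "uniformity = (INF e\<in>{0<..}. principal {(x :: 'a ell2, y). dist x y < e})"
    by (rule uniformity_ell2_def)
  show "open U = (\<forall>x\<in>U. \<forall>\<^sub>F (x', y) in uniformity. x' = x \<longrightarrow> y \<in> U)" for U :: "'a ell2 set"
    by (rule open_ell2_def)
  show "(norm x = 0) = (x = 0)"
    by (auto simp: norm_ell2.rep_eq ell2_summable suminf_eq_zero_iff zero_ell2.rep_eq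
        intro: ell2_eqI)
  show "norm (x + y) \<le> norm x + norm y"
  proof (subst norm_ell2_le_iff; safe?)
    fix N
    have "L2_set (\<lambda>k. norm (ell2_nth (x + y) k)) {..<N}
        \<le> L2_set (\<lambda>k. norm (ell2_nth x k) + norm (ell2_nth y k)) {..<N}"
      by (intro L2_set_mono) (auto simp: plus_ell2.rep_eq norm_triangle_ineq)
    also have "\<dots> \<le> norm x + norm y"
      by (intro order_trans[OF L2_set_triangle_ineq] add_mono L2_set_le_norm_ell2)
    finally show "L2_set (\<lambda>k. norm (ell2_nth (x + y) k)) {..<N} \<le> norm x + norm y" .
  qed (simp add: norm_ell2_nonneg)
  show "norm (a *\<^sub>R x) = \<bar>a\<bar> * norm x"
    by (simp add: norm_ell2.rep_eq scaleR_ell2.rep_eq power_mult_distrib ell2_summable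
        suminf_mult real_sqrt_mult)
qed

end

lemma norm_ell2_nth_le: "norm (ell2_nth x k) \<le> norm x"
proof -
  have "norm (ell2_nth x k) \<le> L2_set (\<lambda>k. norm (ell2_nth x k)) {..<Suc k}"
    by (rule member_le_L2_set) auto
  then show ?thesis using L2_set_le_norm_ell2 order_trans by blast
qed

instantiation ell2 :: (chilbert_space) chilbert_space
begin

lift_definition scaleC_ell2 :: "complex \<Rightarrow> 'a ell2 \<Rightarrow> 'a ell2" is "\<lambda>c x k. c *\<^sub>C x k"
  by (rule square_summable_scaleC)
lift_definition cinner_ell2 :: "'a ell2 \<Rightarrow> 'a ell2 \<Rightarrow> complex" is
  "\<lambda>x y. \<Sum>k. cinner (x k) (y k)" .

lemma summable_cinner: "summable (\<lambda>k. cinner (ell2_nth x k) (ell2_nth y k))"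
proof (rule summable_comparison_test')
  show "summable (\<lambda>k. ((norm (ell2_nth x k))\<^sup>2 + (norm (ell2_nth y k))\<^sup>2) / 2)"
    by (intro summable_divide summable_add ell2_summable)
qed (rule norm_cinner_le)

instance
proof
  fix X :: "nat \<Rightarrow> 'a ell2"
  assume X: "Cauchy X"
  have "Cauchy (\<lambda>n. ell2_nth (X n) k)" for k
  proof (rule metric_CauchyI)
    fix e :: real assume "0 < e"
    then obtain M where M: "\<And>m n. m \<ge> M \<Longrightarrow> n \<ge> M \<Longrightarrow> dist (X m) (X n) < e"
      using metric_CauchyD[OF X] by blast
    have "dist (ell2_nth (X m) k) (ell2_nth (X n) k) \<le> dist (X m) (X n)" for m n
      using norm_ell2_nth_le[of "X m - X n" k] by (simp add: dist_norm minus_ell2.rep_eq)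
    then show "\<exists>M. \<forall>m\<ge>M. \<forall>n\<ge>M. dist (ell2_nth (X m) k) (ell2_nth (X n) k) < e"
      using M by (meson order.strict_trans1)
  qed
  then have "\<exists>y. \<forall>k. (\<lambda>n. ell2_nth (X n) k) \<longlonglongrightarrow> y k"
    by (intro choice allI) (simp add: Cauchy_convergent_iff convergent_def)
  then obtain y where y: "\<And>k. (\<lambda>n. ell2_nth (X n) k) \<longlonglongrightarrow> y k"
    by blast
  have close: "\<exists>M. \<forall>m\<ge>M. \<forall>N. L2_set (\<lambda>k. norm (ell2_nth (X m) k - y k)) {..<N} \<le> e"
    if "0 < e" for e :: real
  proof -
    obtain M where M: "\<And>m n. m \<ge> M \<Longrightarrow> n \<ge> M \<Longrightarrow> dist (X m) (X n) < e"
      using metric_CauchyD[OF X \<open>0 < e\<close>] by blast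
    have "L2_set (\<lambda>k. norm (ell2_nth (X m) k - y k)) {..<N} \<le> e" if "m \<ge> M" for m N
    proof (rule tendsto_upperbound)
      show "(\<lambda>n. L2_set (\<lambda>k. norm (ell2_nth (X m) k - ell2_nth (X n) k)) {..<N})
          \<longlonglongrightarrow> L2_set (\<lambda>k. norm (ell2_nth (X m) k - y k)) {..<N}"
        unfolding L2_set_def by (intro tendsto_intros y)
      have "L2_set (\<lambda>k. norm (ell2_nth (X m) k - ell2_nth (X n) k)) {..<N} \<le> e" if "n \<ge> M" for n
        using L2_set_le_norm_ell2[of "X m - X n" N] M[OF \<open>m \<ge> M\<close> that]
        by (simp add: dist_norm minus_ell2.rep_eq)
      then show "\<forall>\<^sub>F n in sequentially.
          L2_set (\<lambda>k. norm (ell2_nth (X m) k - ell2_nth (X n) k)) {..<N} \<le> e"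
        by (auto simp: eventually_sequentially)
    qed simp
    then show ?thesis by blast
  qed
  obtain M where "\<forall>N. L2_set (\<lambda>k. norm (ell2_nth (X M) k - y k)) {..<N} \<le> 1"
    using close[of 1] by auto
  then have "summable (\<lambda>k. (norm (ell2_nth (X M) k - y k))\<^sup>2)"
    using suminf_square_le_iff[of 1] by fastforce
  from square_summable_minus[of "ell2_nth (X M)", OF ell2_summable this]
  have sy: "summable (\<lambda>k. (norm (y k))\<^sup>2)"
    by simp
  define Y where "Y = Abs_ell2 y"
  have Y: "ell2_nth Y = y"
    unfolding Y_def by (rule Abs_ell2_inverse) (simp add: sy)
  have "X \<longlonglongrightarrow> Y"
  proof (rule metric_LIMSEQ_I)
    fix e :: real assume "0 < e"
    then obtain M where "\<forall>m\<ge>M. \<forall>N. L2_set (\<lambda>k. norm (ell2_nth (X m) k - y k)) {..<N} \<le> e / 2"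
      using close[of "e / 2"] by auto
    then have "dist (X m) Y \<le> e / 2" if "m \<ge> M" for m
      using that \<open>0 < e\<close> norm_ell2_le_iff[of "e / 2" "X m - Y"]
      by (simp add: dist_norm minus_ell2.rep_eq Y)
    moreover have "e / 2 < e" using \<open>0 < e\<close> by simp
    ultimately show "\<exists>M. \<forall>m\<ge>M. dist (X m) Y < e"
      by (meson order.strict_trans1)
  qed
  then show "convergent X" by (auto simp: convergent_def)
next
  fix x y z :: "'a ell2" and c d :: complex and r :: real
  show "c *\<^sub>C (x + y) = c *\<^sub>C x + c *\<^sub>C y" by transfer (simp add: scaleC_add_right)
  show "(c + d) *\<^sub>C x = c *\<^sub>C x + d *\<^sub>C x"
    by (rule ell2_eqI) (simp only: plus_ell2.rep_eq scaleC_ell2.rep_eq scaleC_add_left)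
  show "c *\<^sub>C d *\<^sub>C x = (c * d) *\<^sub>C x" by transfer (simp add: scaleC_scaleC)
  show "r *\<^sub>R x = complex_of_real r *\<^sub>C x"
    by (rule ell2_eqI) (simp only: scaleR_ell2.rep_eq scaleC_ell2.rep_eq scaleR_scaleC)
  show "cinner (x + y) z = cinner x z + cinner y z"
    unfolding cinner_ell2.rep_eq plus_ell2.rep_eq cinner_add_left
    by (rule suminf_add[OF summable_cinner summable_cinner, symmetric])
  show "cinner (c *\<^sub>C x) y = c * cinner x y"
    unfolding cinner_ell2.rep_eq scaleC_ell2.rep_eq cinner_scaleC_left
    by (rule suminf_mult[OF summable_cinner])
  have "(\<lambda>k. cnj (cinner (ell2_nth y k) (ell2_nth x k))) sums cnj (cinner y x)"
    unfolding cinner_ell2.rep_eq sums_cnj by (rule summable_sums[OF summable_cinner])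
  then have "(\<lambda>k. cinner (ell2_nth x k) (ell2_nth y k)) sums cnj (cinner y x)"
    unfolding cinner_commute[symmetric] .
  then show "cinner x y = cnj (cinner y x)"
    unfolding cinner_ell2.rep_eq[of x y] by (rule sums_unique[symmetric])
  have "(\<lambda>k. Re (cinner (ell2_nth x k) (ell2_nth x k))) sums Re (cinner x x)"
    unfolding cinner_ell2.rep_eq by (rule sums_Re[OF summable_sums[OF summable_cinner]])
  then show "norm x = sqrt (Re (cinner x x))"
    by (simp only: norm_ell2.rep_eq sums_iff cinner_self Re_complex_of_real)
qed

end

definition C0 :: "('a::topological_space \<Rightarrow> complex) set" where
  "C0 = {f. continuous_on UNIV f \<and> (\<forall>e>0. compact {x. e \<le> cmod (f x)})}"

definition sup_norm :: "('a \<Rightarrow> complex) \<Rightarrow> real" where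
  "sup_norm f = (SUP x. cmod (f x))"

definition faithful_star_rep ::
  "(('a::topological_space \<Rightarrow> complex) \<Rightarrow> 'h::chilbert_space \<Rightarrow>\<^sub>L 'h) \<Rightarrow> bool" where
  "faithful_star_rep \<rho> \<longleftrightarrow>
     (\<forall>f\<in>C0. \<forall>c \<xi>. blinfun_apply (\<rho> f) (c *\<^sub>C \<xi>) = c *\<^sub>C blinfun_apply (\<rho> f) \<xi>) \<and>
     (\<forall>f\<in>C0. \<forall>g\<in>C0. \<rho> (\<lambda>x. f x + g x) = \<rho> f + \<rho> g) \<and>
     (\<forall>f\<in>C0. \<forall>c \<xi>. blinfun_apply (\<rho> (\<lambda>x. c * f x)) \<xi> = c *\<^sub>C blinfun_apply (\<rho> f) \<xi>) \<and>
     (\<forall>f\<in>C0. \<forall>g\<in>C0. \<rho> (\<lambda>x. f x * g x) = \<rho> f o\<^sub>L \<rho> g) \<and>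
     (\<forall>f\<in>C0. \<forall>\<xi> \<eta>. cinner (blinfun_apply (\<rho> f) \<xi>) \<eta>
        = cinner \<xi> (blinfun_apply (\<rho> (\<lambda>x. cnj (f x))) \<eta>)) \<and>
     inj_on \<rho> C0"

text \<open>A formal series with coefficients \<open>f\<^sub>n\<close> is represented by the sequence \<open>f\<close>.\<close>

definition l1_C0 :: "(nat \<Rightarrow> 'a::topological_space \<Rightarrow> complex) set" where
  "l1_C0 = {f. (\<forall>n. f n \<in> C0) \<and> summable (\<lambda>n. sup_norm (f n))}"

text \<open>The operator \<open>U\<^sup>n f\<close>: it maps the elementary tensor of \<open>\<xi>\<close> and \<open>e\<^sub>k\<close> to that of
  \<open>\<rho> (f \<circ> \<phi>\<^sup>k) \<xi>\<close> and \<open>e\<^sub>k\<^sub>+\<^sub>n\<close>, so the entry in place \<open>m \<ge> n\<close> of the image of a sequence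
  comes from the entry in place \<open>m - n\<close>.\<close>

definition pi_mono ::
  "(('a::topological_space \<Rightarrow> complex) \<Rightarrow> 'h::chilbert_space \<Rightarrow>\<^sub>L 'h) \<Rightarrow> ('a \<Rightarrow> 'a)
    \<Rightarrow> nat \<Rightarrow> ('a \<Rightarrow> complex) \<Rightarrow> 'h ell2 \<Rightarrow>\<^sub>L 'h ell2" where
  "pi_mono \<rho> \<phi> n f = Blinfun (\<lambda>x. Abs_ell2 (\<lambda>m.
     if m < n then 0 else blinfun_apply (\<rho> (f \<circ> (\<phi> ^^ (m - n)))) (ell2_nth x (m - n))))"

definition pi_rep ::
  "(('a::topological_space \<Rightarrow> complex) \<Rightarrow> 'h::chilbert_space \<Rightarrow>\<^sub>L 'h) \<Rightarrow> ('a \<Rightarrow> 'a)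
    \<Rightarrow> (nat \<Rightarrow> 'a \<Rightarrow> complex) \<Rightarrow> 'h ell2 \<Rightarrow>\<^sub>L 'h ell2" where
  "pi_rep \<rho> \<phi> f = (\<Sum>n. pi_mono \<rho> \<phi> n (f n))"

definition semicrossed_product ::
  "(('a::topological_space \<Rightarrow> complex) \<Rightarrow> 'h::chilbert_space \<Rightarrow>\<^sub>L 'h) \<Rightarrow> ('a \<Rightarrow> 'a)
    \<Rightarrow> ('h ell2 \<Rightarrow>\<^sub>L 'h ell2) set" where
  "semicrossed_product \<rho> \<phi> = closure (pi_rep \<rho> \<phi> ` l1_C0)"

text \<open>The Fourier coefficient \<open>E\<^sub>n A\<close>, as the value at \<open>A\<close> of the continuous extension, from
  the operator norm to the supremum norm, of the map taking \<open>pi_rep \<rho> \<phi> f\<close> to \<open>f n\<close>.\<close>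

definition fourier_coeff ::
  "(('a::topological_space \<Rightarrow> complex) \<Rightarrow> 'h::chilbert_space \<Rightarrow>\<^sub>L 'h) \<Rightarrow> ('a \<Rightarrow> 'a)
    \<Rightarrow> nat \<Rightarrow> ('h ell2 \<Rightarrow>\<^sub>L 'h ell2) \<Rightarrow> 'a \<Rightarrow> complex" where
  "fourier_coeff \<rho> \<phi> n A = (THE g. g \<in> C0 \<and>
     (\<forall>F :: nat \<Rightarrow> nat \<Rightarrow> 'a \<Rightarrow> complex. (\<forall>j. F j \<in> l1_C0) \<longrightarrow> (\<lambda>j. pi_rep \<rho> \<phi> (F j)) \<longlonglongrightarrow> A
        \<longrightarrow> (\<lambda>j. sup_norm (\<lambda>x. F j n x - g x)) \<longlonglongrightarrow> 0))"

definition assoc_ideal ::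
  "(('a::topological_space \<Rightarrow> complex) \<Rightarrow> 'h::chilbert_space \<Rightarrow>\<^sub>L 'h) \<Rightarrow> ('a \<Rightarrow> 'a)
    \<Rightarrow> (nat \<Rightarrow> 'a set) \<Rightarrow> ('h ell2 \<Rightarrow>\<^sub>L 'h ell2) set" where
  "assoc_ideal \<rho> \<phi> X =
     {A \<in> semicrossed_product \<rho> \<phi>. \<forall>n. \<forall>x\<in>X n. fourier_coeff \<rho> \<phi> n A x = 0}"

definition directed_preorder :: "'i set \<Rightarrow> ('i \<Rightarrow> 'i \<Rightarrow> bool) \<Rightarrow> bool" where
  "directed_preorder \<Lambda> le \<longleftrightarrow> \<Lambda> \<noteq> {} \<and> (\<forall>i\<in>\<Lambda>. le i i) \<and>
     (\<forall>i\<in>\<Lambda>. \<forall>j\<in>\<Lambda>. \<forall>k\<in>\<Lambda>. le i j \<longrightarrow> le j k \<longrightarrow> le i k) \<and>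
     (\<forall>i\<in>\<Lambda>. \<forall>j\<in>\<Lambda>. \<exists>k\<in>\<Lambda>. le i k \<and> le j k)"

definition net_tendsto ::
  "'i set \<Rightarrow> ('i \<Rightarrow> 'i \<Rightarrow> bool) \<Rightarrow> ('i \<Rightarrow> 'b::metric_space) \<Rightarrow> 'b \<Rightarrow> bool" where
  "net_tendsto \<Lambda> le u l \<longleftrightarrow> (\<forall>e>0. \<exists>i\<in>\<Lambda>. \<forall>j\<in>\<Lambda>. le i j \<longrightarrow> dist (u j) l < e)"

definition left_approximate_unit ::
  "('b::real_normed_vector \<Rightarrow>\<^sub>L 'b) set \<Rightarrow> 'i set \<Rightarrow> ('i \<Rightarrow> 'i \<Rightarrow> bool) \<Rightarrow> ('i \<Rightarrow> 'b \<Rightarrow>\<^sub>L 'b) \<Rightarrow> bool"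
  where
  "left_approximate_unit I \<Lambda> le u \<longleftrightarrow> directed_preorder \<Lambda> le \<and> (\<forall>i\<in>\<Lambda>. u i \<in> I) \<and>
     (\<exists>r>0. \<forall>i\<in>\<Lambda>. norm (u i) \<le> r) \<and> (\<forall>a\<in>I. net_tendsto \<Lambda> le (\<lambda>i. u i o\<^sub>L a) a)"

text \<open>An existential quantifier cannot range over the index type of a net. The index type
  chosen here is no restriction, by the lemma following the definition.\<close>

definition has_left_approximate_unit :: "('b::real_normed_vector \<Rightarrow>\<^sub>L 'b) set \<Rightarrow> bool" where
  "has_left_approximate_unit I \<longleftrightarrow>
     (\<exists>(\<Lambda> :: (('b \<Rightarrow>\<^sub>L 'b) set \<times> ('b \<Rightarrow>\<^sub>L 'b)) set) le u. left_approximate_unit I \<Lambda> le u)"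

lemma left_approximate_unit_imp_has:
  fixes \<Lambda> :: "'i set"
  assumes "left_approximate_unit I \<Lambda> le u"
  shows "has_left_approximate_unit I"
proof -
  from assms have ne: "\<Lambda> \<noteq> {}" and refl: "\<And>i. i \<in> \<Lambda> \<Longrightarrow> le i i"
    and trans: "\<And>i j k. \<lbrakk>i \<in> \<Lambda>; j \<in> \<Lambda>; k \<in> \<Lambda>; le i j; le j k\<rbrakk> \<Longrightarrow> le i k"
    and dir: "\<And>i j. \<lbrakk>i \<in> \<Lambda>; j \<in> \<Lambda>\<rbrakk> \<Longrightarrow> \<exists>k\<in>\<Lambda>. le i k \<and> le j k"
    and mem: "\<And>i. i \<in> \<Lambda> \<Longrightarrow> u i \<in> I"
    and bdd: "\<exists>r>0. \<forall>i\<in>\<Lambda>. norm (u i) \<le> r"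
    and lim: "\<And>a. a \<in> I \<Longrightarrow> net_tendsto \<Lambda> le (\<lambda>i. u i o\<^sub>L a) a"
    unfolding left_approximate_unit_def directed_preorder_def by blast+
  define T where "T i = u ` {j \<in> \<Lambda>. le i j}" for i
  define \<Lambda>' where "\<Lambda>' = {(T i, v) | i v. i \<in> \<Lambda> \<and> v \<in> T i}"
  define le' where "le' p q \<longleftrightarrow> fst q \<subseteq> fst p" for p q :: "('a \<Rightarrow>\<^sub>L 'a) set \<times> ('a \<Rightarrow>\<^sub>L 'a)"
  have in': "(T i, u i) \<in> \<Lambda>'" if "i \<in> \<Lambda>" for i
    unfolding \<Lambda>'_def T_def using that refl by blast
  have T_mono: "T k \<subseteq> T i" if "i \<in> \<Lambda>" "k \<in> \<Lambda>" "le i k" for i k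
    unfolding T_def using that by (intro image_mono subsetI) (use trans in blast)
  have "directed_preorder \<Lambda>' le'"
    unfolding directed_preorder_def
  proof (intro conjI ballI impI)
    show "\<Lambda>' \<noteq> {}" using ne in' by blast
    fix p q assume "p \<in> \<Lambda>'" "q \<in> \<Lambda>'"
    then obtain i j where ij: "i \<in> \<Lambda>" "fst p = T i" "j \<in> \<Lambda>" "fst q = T j"
      by (auto simp: \<Lambda>'_def)
    then obtain k where k: "k \<in> \<Lambda>" "le i k" "le j k" using dir by blast
    then show "\<exists>r\<in>\<Lambda>'. le' p r \<and> le' q r"
      using in'[OF k(1)] T_mono ij unfolding le'_def by (metis fst_conv)
  qed (auto simp: le'_def)
  moreover have "\<forall>p\<in>\<Lambda>'. \<exists>i\<in>\<Lambda>. snd p = u i"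
    by (auto simp: \<Lambda>'_def T_def)
  then have "\<forall>p\<in>\<Lambda>'. snd p \<in> I" "\<exists>r>0. \<forall>p\<in>\<Lambda>'. norm (snd p) \<le> r"
    using mem bdd by metis+
  moreover have "net_tendsto \<Lambda>' le' (\<lambda>p. snd p o\<^sub>L a) a" if a: "a \<in> I" for a
    unfolding net_tendsto_def
  proof (intro allI impI)
    fix e :: real assume "0 < e"
    then obtain i where i: "i \<in> \<Lambda>" "\<And>j. j \<in> \<Lambda> \<Longrightarrow> le i j \<Longrightarrow> dist (u j o\<^sub>L a) a < e"
      using lim[OF a] unfolding net_tendsto_def by blast
    have "dist (snd p o\<^sub>L a) a < e" if "p \<in> \<Lambda>'" "le' (T i, u i) p" for p
    proof -
      have "snd p \<in> T i"
        using that by (auto simp: \<Lambda>'_def le'_def)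
      then show ?thesis
        using i(2) by (auto simp: T_def)
    qed
    then show "\<exists>p\<in>\<Lambda>'. \<forall>q\<in>\<Lambda>'. le' p q \<longrightarrow> dist (snd q o\<^sub>L a) a < e"
      using in'[OF i(1)] by blast
  qed
  ultimately show ?thesis
    unfolding has_left_approximate_unit_def left_approximate_unit_def by blast
qed

end

theory Submission
  imports Defs
begin

text \<open>Faithful *-representations of \<open>C\<^sub>0(X)\<close> are isometric, so an operator of the semicrossed
  product is a lower triangular matrix whose entries determine its Fourier coefficients. If \<open>f\<close>
  vanishes on \<open>X\<^sub>n\<close> but not at \<open>y\<close>, then \<open>uU\<^sup>nf\<close> has \<open>n\<close>-th coefficient \<open>(E\<^sub>0(u) \<circ> \<phi>\<^sup>n) f\<close>; it can
  be close to \<open>f\<close> for some \<open>u\<close> in the ideal only if \<open>\<phi>\<^sup>n(y) \<notin> X\<^sub>0\<close>. Conversely, if \<open>\<phi>\<^sup>n\<close> maps the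
  complement of \<open>X\<^sub>n\<close> into that of \<open>X\<^sub>0\<close>, then an approximate unit of \<open>C\<^sub>0(X - X\<^sub>0)\<close> is a left
  approximate unit for all monomials \<open>U\<^sup>nf\<close> of the ideal, and these span a dense subspace since
  Cesaro means of Fourier series converge in norm.\<close>

section \<open>Functions vanishing at infinity\<close>

text \<open>Faithfulness is given only as injectivity of a *-homomorphism, so the isometry of
  \<open>\<rho>\<close> has to be derived, here by functional calculus tested on vectors. Reading
  off column 0 of a matrix then bounds every coefficient by the operator norm. Hence coefficients
  pass to norm limits, and \<open>fourier_coeff\<close>, a definite description over all
  approximating sequences, becomes computable. Density is the delicate point: partial sums of a
  Fourier series need not converge in norm, and the elements approximating a member of the ideal
  need not lie in the ideal. Cesaro means avoid both obstacles, because their terms are scalar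
  multiples of the member's own coefficients. The step from (1) to (2) gives an inclusion first;
  surjectivity makes it an equality, since \<open>\<phi> ^^ n\<close> maps \<open>X n\<close> into
  \<open>X 0\<close>. The equivalence of (2) and (3) is pure set theory, where the non-zero ideal
  excludes the case that every \<open>X n\<close> is the whole space.\<close>

lemma C0_I:
  fixes f :: "'a::t2_space \<Rightarrow> complex"
  assumes "continuous_on UNIV f"
    and "\<And>e. 0 < e \<Longrightarrow> \<exists>K. compact K \<and> (\<forall>x. e \<le> cmod (f x) \<longrightarrow> x \<in> K)"
  shows "f \<in> C0"
proof -
  have "compact {x. e \<le> cmod (f x)}" if "0 < e" for e
  proof -
    obtain K where K: "compact K" "\<And>x. e \<le> cmod (f x) \<Longrightarrow> x \<in> K"
      using assms(2) \<open>0 < e\<close> by blast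
    have "closed {x. e \<le> cmod (f x)}"
      by (intro closed_Collect_le continuous_intros assms(1))
    moreover have "{x. e \<le> cmod (f x)} = K \<inter> {x. e \<le> cmod (f x)}"
      using K(2) by blast
    ultimately show ?thesis
      using K(1) by (metis compact_Int_closed)
  qed
  then show ?thesis
    using assms(1) by (simp add: C0_def)
qed

lemma C0_continuous: "f \<in> C0 \<Longrightarrow> continuous_on UNIV f"
  by (simp add: C0_def)

lemma C0_compact: "f \<in> C0 \<Longrightarrow> 0 < e \<Longrightarrow> compact {x. e \<le> cmod (f x)}"
  by (simp add: C0_def)

text \<open>Continuity of \<open>g\<close> at 0 makes \<open>f x\<close> bounded away from 0
  wherever \<open>g (f x)\<close> is. This is the functional calculus that produces the square roots
  and truncations below.\<close>

lemma C0_compose: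
  fixes f :: "'a::t2_space \<Rightarrow> complex"
  assumes f: "f \<in> C0" and g: "continuous_on UNIV g" and g0: "g 0 = 0"
  shows "(\<lambda>x. g (f x)) \<in> C0"
proof (rule C0_I)
  show "continuous_on UNIV (\<lambda>x. g (f x))"
    by (rule continuous_on_compose2[OF g C0_continuous[OF f]]) simp
  fix e :: real
  assume "0 < e"
  moreover have "isCont g 0"
    using g by (simp add: continuous_on_eq_continuous_at)
  ultimately obtain d where d: "0 < d" "\<And>z. cmod z < d \<Longrightarrow> cmod (g z) < e"
    unfolding continuous_at_eps_delta by (auto simp: g0)
  have "x \<in> {x. d \<le> cmod (f x)}" if "e \<le> cmod (g (f x))" for x
    using d(2)[of "f x"] that by (force simp: not_le[symmetric])
  then show "\<exists>K. compact K \<and> (\<forall>x. e \<le> cmod (g (f x)) \<longrightarrow> x \<in> K)"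
    using C0_compact[OF f d(1)] by blast
qed

lemma C0_zero: "(\<lambda>x::'a::t2_space. 0) \<in> C0"
  by (rule C0_I) auto

lemma C0_cnj: "f \<in> C0 \<Longrightarrow> (\<lambda>x::'a::t2_space. cnj (f x)) \<in> C0"
  by (rule C0_compose) (auto intro: continuous_intros)

lemma C0_scale: "f \<in> C0 \<Longrightarrow> (\<lambda>x::'a::t2_space. c * f x) \<in> C0"
  by (rule C0_compose) (auto intro: continuous_intros)

lemma C0_add:
  fixes f g :: "'a::t2_space \<Rightarrow> complex"
  assumes "f \<in> C0" "g \<in> C0"
  shows "(\<lambda>x. f x + g x) \<in> C0"
proof (rule C0_I)
  show "continuous_on UNIV (\<lambda>x. f x + g x)"
    using assms by (intro continuous_intros C0_continuous)
  fix e :: real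
  assume "0 < e"
  have "x \<in> {x. e / 2 \<le> cmod (f x)} \<union> {x. e / 2 \<le> cmod (g x)}" if "e \<le> cmod (f x + g x)" for x
    using norm_triangle_ineq[of "f x" "g x"] that by auto
  then show "\<exists>K. compact K \<and> (\<forall>x. e \<le> cmod (f x + g x) \<longrightarrow> x \<in> K)"
    using C0_compact[OF assms(1), of "e / 2"] C0_compact[OF assms(2), of "e / 2"] \<open>0 < e\<close>
    by (intro exI[of _ "{x. e / 2 \<le> cmod (f x)} \<union> {x. e / 2 \<le> cmod (g x)}"]) (auto intro: compact_Un)
qed

lemma C0_diff: "f \<in> C0 \<Longrightarrow> g \<in> C0 \<Longrightarrow> (\<lambda>x::'a::t2_space. f x - g x) \<in> C0"
  using C0_add[of f "\<lambda>x. - 1 * g x"] C0_scale[of g "- 1"] by simp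

lemma C0_bounded:
  fixes f :: "'a::t2_space \<Rightarrow> complex"
  assumes "f \<in> C0"
  obtains B where "0 < B" "\<And>x. cmod (f x) \<le> B"
proof -
  have "compact (f ` {x. 1 \<le> cmod (f x)})"
    using assms by (intro compact_continuous_image C0_compact)
      (auto intro: continuous_on_subset C0_continuous)
  then obtain B where B: "\<And>x. 1 \<le> cmod (f x) \<Longrightarrow> cmod (f x) \<le> B"
    using compact_imp_bounded bounded_iff by (metis (mono_tags, lifting) imageI mem_Collect_eq)
  have "cmod (f x) \<le> max 1 B" for x
    using B[of x] by linarith
  then show ?thesis
    using that[of "max 1 B"] by auto
qed

lemma C0_mult:
  fixes f g :: "'a::t2_space \<Rightarrow> complex"
  assumes f: "f \<in> C0" and g: "g \<in> C0"
  shows "(\<lambda>x. f x * g x) \<in> C0"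
proof (rule C0_I)
  show "continuous_on UNIV (\<lambda>x. f x * g x)"
    using assms by (intro continuous_intros C0_continuous)
  fix e :: real
  assume "0 < e"
  obtain B where B: "0 < B" "\<And>x. cmod (f x) \<le> B"
    using C0_bounded[OF f] by blast
  have "e / B \<le> cmod (g x)" if "e \<le> cmod (f x * g x)" for x
  proof -
    have "e \<le> B * cmod (g x)"
      using that mult_right_mono[OF B(2)[of x], of "cmod (g x)"] by (simp add: norm_mult)
    then show ?thesis
      using B(1) by (simp add: field_simps)
  qed
  then show "\<exists>K. compact K \<and> (\<forall>x. e \<le> cmod (f x * g x) \<longrightarrow> x \<in> K)"
    using C0_compact[OF g, of "e / B"] \<open>0 < e\<close> B(1)
    by (intro exI[of _ "{x. e / B \<le> cmod (g x)}"]) auto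
qed

lemma norm_le_sup_norm:
  fixes f :: "'a::t2_space \<Rightarrow> complex"
  assumes "f \<in> C0"
  shows "cmod (f x) \<le> sup_norm f"
proof -
  obtain B where "\<And>x. cmod (f x) \<le> B"
    using C0_bounded[OF assms] by blast
  then have "bdd_above (range (\<lambda>x. cmod (f x)))"
    by (auto intro!: bdd_aboveI)
  then show ?thesis
    unfolding sup_norm_def by (rule cSUP_upper[rotated]) simp
qed

lemma sup_norm_le: "(\<And>x. cmod (f x) \<le> B) \<Longrightarrow> sup_norm f \<le> B"
  unfolding sup_norm_def by (rule cSUP_least) auto

lemma sup_norm_nonneg: "f \<in> C0 \<Longrightarrow> 0 \<le> sup_norm (f :: 'a::t2_space \<Rightarrow> complex)"
  using norm_le_sup_norm order_trans norm_ge_zero by blast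

text \<open>A uniform limit is at least \<open>e\<close> only where a close \<open>f j\<close> is at
  least \<open>e / 2\<close>. This completeness supplies the coefficients of norm limits in
  \<open>has_coeffs_limit\<close>.\<close>

lemma C0_Cauchy_limit:
  fixes f :: "nat \<Rightarrow> 'a::t2_space \<Rightarrow> complex"
  assumes f: "\<And>j. f j \<in> C0"
    and cauchy: "\<And>e. 0 < e \<Longrightarrow> \<exists>M. \<forall>i\<ge>M. \<forall>j\<ge>M. \<forall>x. cmod (f i x - f j x) < e"
  obtains g where "g \<in> C0" "uniform_limit UNIV f g sequentially"
proof -
  have "uniformly_Cauchy_on UNIV f"
    unfolding uniformly_Cauchy_on_def dist_norm using cauchy by blast
  then obtain g where g: "uniform_limit UNIV f g sequentially"
    by (meson Cauchy_uniformly_convergent uniformly_convergent_on_def)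
  have "g \<in> C0"
  proof (rule C0_I)
    show "continuous_on UNIV g"
      by (rule uniform_limit_theorem[OF _ g]) (simp_all add: C0_continuous f)
    fix e :: real
    assume "0 < e"
    then have "\<forall>\<^sub>F j in sequentially. \<forall>x\<in>UNIV. dist (f j x) (g x) < e / 2"
      by (intro uniform_limitD[OF g]) simp
    then obtain j where j: "\<And>x. cmod (f j x - g x) < e / 2"
      by (auto simp: dist_norm eventually_sequentially)
    have "x \<in> {x. e / 2 \<le> cmod (f j x)}" if "e \<le> cmod (g x)" for x
      using that j[of x] norm_triangle_ineq2[of "g x" "f j x"]
      by (simp add: norm_minus_commute)
    then show "\<exists>K. compact K \<and> (\<forall>x. e \<le> cmod (g x) \<longrightarrow> x \<in> K)"
      using C0_compact[OF f, of "e / 2" j] \<open>0 < e\<close>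
      by (intro exI[of _ "{x. e / 2 \<le> cmod (f j x)}"]) simp
  qed
  then show ?thesis
    using g that by blast
qed

text \<open>The bound on \<open>1 - f\<close> is for the approximate unit: the error
  \<open>(1 - f) g\<close> never exceeds \<open>g\<close> in modulus, even where \<open>f\<close> is
  strictly between 0 and 1.\<close>

lemma locally_compact_Urysohn:
  fixes K U :: "'a::t2_space set"
  assumes lc: "locally_compact_space (euclidean :: 'a topology)"
    and K: "compact K" and U: "open U" "K \<subseteq> U"
  obtains f :: "'a \<Rightarrow> complex"
  where "f \<in> C0" "\<And>x. x \<in> K \<Longrightarrow> f x = 1" "\<And>x. x \<notin> U \<Longrightarrow> f x = 0"
    "\<And>x. cmod (f x) \<le> 1" "\<And>x. cmod (1 - f x) \<le> 1"
proof -
  have "\<forall>x::'a. \<exists>V L. open V \<and> compact L \<and> x \<in> V \<and> V \<subseteq> L"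
    using lc by (simp add: locally_compact_space_def)
  from choice[OF this] obtain V
    where "\<forall>x::'a. \<exists>L. open (V x) \<and> compact L \<and> x \<in> V x \<and> V x \<subseteq> L" ..
  from choice[OF this] obtain L
    where "\<forall>x. open (V x) \<and> compact (L x) \<and> x \<in> V x \<and> V x \<subseteq> L x" ..
  then have VL: "open (V x)" "compact (L x)" "x \<in> V x" "V x \<subseteq> L x" for x
    by blast+
  obtain D where D: "finite D" "K \<subseteq> (\<Union>x\<in>D. V x)"
  proof (rule compactE_image[OF K, of K V])
    show "K \<subseteq> (\<Union>x\<in>K. V x)" using VL(3) by blast
  qed (use VL(1) in auto)
  \<comment> \<open>Shrinking \<open>U\<close> to a set covered by finitely many compact
    \<open>L x\<close> makes the function vanish off a compact set, hence at infinity.\<close>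
  define W where "W = U \<inter> (\<Union>x\<in>D. V x)"
  have "open W"
    using U VL(1) by (auto simp: W_def)
  have "\<exists>U V. open U \<and> open V \<and> x \<in> U \<and> y \<in> V \<and> U \<inter> V = {}" if "x \<noteq> y" for x y :: 'a
    using that by (rule hausdorff)
  then have "Hausdorff_space (euclidean :: 'a topology)"
    by (simp add: Hausdorff_space_def disjnt_def)
  then have cr: "completely_regular_space (euclidean :: 'a topology)"
    using lc by (intro locally_compact_regular_imp_completely_regular_space) auto
  obtain f where f: "continuous_map euclidean (top_of_set {0..1::real}) f" "f ` (- W) \<subseteq> {0}" "f ` K \<subseteq> {1}"
  proof (rule Urysohn_completely_regular_compact_closed[OF zero_le_one cr, of K "- W" ])
    show "disjnt K (- W)"
      using U(2) D(2) by (auto simp: W_def disjnt_def)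
  qed (use K \<open>open W\<close> in \<open>simp_all add: closed_Compl\<close>)
  have cont: "continuous_on UNIV f" and rng: "\<And>x. 0 \<le> f x \<and> f x \<le> 1"
    using f(1) by (auto simp: continuous_map_in_subtopology)
  have "(\<lambda>x. complex_of_real (f x)) \<in> C0"
  proof (rule C0_I)
    show "continuous_on UNIV (\<lambda>x. complex_of_real (f x))"
      by (intro continuous_intros cont)
    fix e :: real
    assume "0 < e"
    have "x \<in> (\<Union>x\<in>D. L x)" if "e \<le> cmod (complex_of_real (f x))" for x
    proof -
      have "f x \<noteq> 0" using that \<open>0 < e\<close> by auto
      then have "x \<in> W" using f(2) by blast
      then show ?thesis using VL(4) by (auto simp: W_def)
    qed
    then show "\<exists>K. compact K \<and> (\<forall>x. e \<le> cmod (complex_of_real (f x)) \<longrightarrow> x \<in> K)"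
      using compact_UN[OF D(1) VL(2)] by (intro exI[of _ "\<Union>x\<in>D. L x"]) simp
  qed
  moreover have "cmod (1 - complex_of_real (f x)) \<le> 1" for x
    using rng[of x] norm_of_real[of "1 - f x", where 'a = complex] by simp
  moreover have "f x = 0" if "x \<notin> U" for x
    using f(2) that by (auto simp: W_def)
  moreover have "f x = 1" if "x \<in> K" for x
    using f(3) that by blast
  ultimately show ?thesis
    using rng by (intro that[of "\<lambda>x. complex_of_real (f x)"]) auto
qed

section \<open>Faithful representations are isometric\<close>

lemma norm_add_square:
  "(norm (x + y))\<^sup>2 = (norm x)\<^sup>2 + 2 * Re (cinner x y) + (norm y)\<^sup>2" for x :: "'h::chilbert_space"
proof -
  have "(norm z)\<^sup>2 = Re (cinner z z)" for z :: 'h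
    by (simp add: cinner_self)
  moreover have "Re (cinner y x) = Re (cinner x y)"
    using cinner_commute[of y x] by simp
  ultimately show ?thesis
    by (simp add: cinner_add_left cinner_add_right)
qed

context
  fixes \<rho> :: "('a::t2_space \<Rightarrow> complex) \<Rightarrow> 'h::chilbert_space \<Rightarrow>\<^sub>L 'h"
  assumes rep: "faithful_star_rep \<rho>"
begin

lemma rep_add: "f \<in> C0 \<Longrightarrow> g \<in> C0 \<Longrightarrow> \<rho> (\<lambda>x. f x + g x) = \<rho> f + \<rho> g"
  using rep by (simp add: faithful_star_rep_def)

lemma rep_scale: "f \<in> C0 \<Longrightarrow> \<rho> (\<lambda>x. c * f x) \<xi> = c *\<^sub>C \<rho> f \<xi>"
  using rep by (simp add: faithful_star_rep_def)

lemma rep_mult: "f \<in> C0 \<Longrightarrow> g \<in> C0 \<Longrightarrow> \<rho> (\<lambda>x. f x * g x) = \<rho> f o\<^sub>L \<rho> g"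
  using rep by (simp add: faithful_star_rep_def)

lemma rep_adjoint: "f \<in> C0 \<Longrightarrow> cinner (\<rho> f \<xi>) \<eta> = cinner \<xi> (\<rho> (\<lambda>x. cnj (f x)) \<eta>)"
  using rep by (simp add: faithful_star_rep_def)

lemma rep_inj: "inj_on \<rho> C0"
  using rep by (simp add: faithful_star_rep_def)

lemma rep_scaleR: "f \<in> C0 \<Longrightarrow> \<rho> (\<lambda>x. complex_of_real r * f x) = r *\<^sub>R \<rho> f"
  by (rule blinfun_eqI) (simp add: rep_scale scaleR_scaleC blinfun.scaleR_left)

lemma rep_zero: "\<rho> (\<lambda>_. 0) = 0"
  using rep_add[OF C0_zero C0_zero] by simp

lemma rep_diff: "f \<in> C0 \<Longrightarrow> g \<in> C0 \<Longrightarrow> \<rho> (\<lambda>x. f x - g x) = \<rho> f - \<rho> g"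
  using rep_add[of f "\<lambda>x. complex_of_real (- 1) * g x"] rep_scaleR[of g "- 1"]
    C0_scale[of g "complex_of_real (- 1)"] by simp

text \<open>The C*-identity tested on a vector. It turns pointwise identities between squared moduli
  into identities between norms.\<close>

lemma norm_rep_square:
  assumes "f \<in> C0"
  shows "(norm (\<rho> f \<xi>))\<^sup>2 = Re (cinner (\<rho> (\<lambda>x. complex_of_real ((cmod (f x))\<^sup>2)) \<xi>) \<xi>)"
proof -
  have "(\<lambda>x. complex_of_real ((cmod (f x))\<^sup>2)) = (\<lambda>x. cnj (f x) * f x)"
    by (simp only: complex_norm_square mult.commute)
  then have "\<rho> (\<lambda>x. complex_of_real ((cmod (f x))\<^sup>2)) \<xi> = \<rho> (\<lambda>x. cnj (f x)) (\<rho> f \<xi>)"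
    by (simp only: rep_mult[OF C0_cnj[OF assms] assms] blinfun_apply_blinfun_compose)
  then show ?thesis
    using rep_adjoint[OF C0_cnj[OF assms], of "\<rho> f \<xi>" \<xi>] by (simp add: cinner_self)
qed

text \<open>Writing \<open>|f|\<^sup>2 = 2Mg - g\<^sup>2\<close> with \<open>g = M - sqrt (M\<^sup>2 - |f|\<^sup>2)\<close> vanishing at infinity replaces
  the usual argument with the positive element \<open>M\<^sup>2 - |f|\<^sup>2\<close> of the unitization.\<close>

lemma norm_rep_apply_le:
  assumes f: "f \<in> C0" and M: "\<And>x. cmod (f x) \<le> M"
  shows "norm (\<rho> f \<xi>) \<le> M * norm \<xi>"
proof -
  have "0 \<le> M"
    using M norm_ge_zero order_trans by blast
  define t where "t x = M - sqrt (M\<^sup>2 - (cmod (f x))\<^sup>2)" for x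
  define g where "g x = complex_of_real (t x)" for x
  have g: "g \<in> C0"
    unfolding g_def t_def using \<open>0 \<le> M\<close>
    by (intro C0_compose[OF f, of "\<lambda>z. complex_of_real (M - sqrt (M\<^sup>2 - (cmod z)\<^sup>2))"] continuous_intros) auto
  have t: "(cmod (f x))\<^sup>2 = 2 * M * t x + - 1 * (t x)\<^sup>2" for x
  proof -
    have "(cmod (f x))\<^sup>2 \<le> M\<^sup>2"
      by (intro power_mono M) simp
    then have "(sqrt (M\<^sup>2 - (cmod (f x))\<^sup>2))\<^sup>2 = M\<^sup>2 - (cmod (f x))\<^sup>2"
      by simp
    then show ?thesis
      unfolding t_def by algebra
  qed
  have eq: "(\<lambda>x. complex_of_real ((cmod (f x))\<^sup>2))
      = (\<lambda>x. complex_of_real (2 * M) * g x + complex_of_real (- 1) * complex_of_real ((cmod (g x))\<^sup>2))"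
    unfolding g_def norm_of_real power2_abs by (simp only: t of_real_add of_real_mult)
  have sq: "(\<lambda>x. complex_of_real ((cmod (g x))\<^sup>2)) \<in> C0"
    by (intro C0_compose[OF g, of "\<lambda>z. complex_of_real ((cmod z)\<^sup>2)"] continuous_intros) auto
  have "\<rho> (\<lambda>x. complex_of_real ((cmod (f x))\<^sup>2)) \<xi>
      = complex_of_real (2 * M) *\<^sub>C \<rho> g \<xi>
        + complex_of_real (- 1) *\<^sub>C \<rho> (\<lambda>x. complex_of_real ((cmod (g x))\<^sup>2)) \<xi>"
    by (simp only: eq rep_add[OF C0_scale[OF g] C0_scale[OF sq]] blinfun.add_left rep_scale[OF g] rep_scale[OF sq])
  then have "(norm (\<rho> f \<xi>))\<^sup>2 = 2 * M * Re (cinner (\<rho> g \<xi>) \<xi>) - (norm (\<rho> g \<xi>))\<^sup>2"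
    by (simp add: norm_rep_square[OF f] norm_rep_square[OF g] cinner_add_left cinner_scaleC_left)
  \<comment> \<open>Completing the square: by the previous equation this norm squared equals the
    difference of \<open>(M * norm \<xi>)\<^sup>2\<close> and
    \<open>(norm (\<rho> f \<xi>))\<^sup>2\<close>, which is therefore nonnegative.\<close>
  moreover have "(norm (\<rho> g \<xi> + complex_of_real (- M) *\<^sub>C \<xi>))\<^sup>2
      = (norm (\<rho> g \<xi>))\<^sup>2 - 2 * M * Re (cinner (\<rho> g \<xi>) \<xi>) + M\<^sup>2 * (norm \<xi>)\<^sup>2"
    by (simp add: norm_add_square cinner_scaleC_right norm_scaleC power_mult_distrib)
  ultimately have "(norm (\<rho> f \<xi>))\<^sup>2 \<le> (M * norm \<xi>)\<^sup>2"
    using zero_le_power2[of "norm (\<rho> g \<xi> + complex_of_real (- M) *\<^sub>C \<xi>)"]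
    by (simp add: power_mult_distrib)
  then show ?thesis
    using \<open>0 \<le> M\<close> by (simp add: power2_le_iff_abs_le)
qed

lemma norm_rep_le:
  assumes "f \<in> C0" "\<And>x. cmod (f x) \<le> M"
  shows "norm (\<rho> f) \<le> M"
proof (rule norm_blinfun_bound)
  show "0 \<le> M"
    using assms(2) norm_ge_zero order_trans by blast
qed (rule norm_rep_apply_le[OF assms])

text \<open>If \<open>\<parallel>\<rho> f\<parallel> < c < |f x|\<close>, then \<open>g = max 0 (|f|\<^sup>2 - c\<^sup>2)\<close> is nonzero and
  \<open>\<rho> f\<close> expands the range of \<open>\<rho> g\<close> by the factor \<open>c\<close>, since \<open>(|f|\<^sup>2 - c\<^sup>2) g\<^sup>2\<close> is a square.\<close>

lemma norm_le_norm_rep: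
  assumes f: "f \<in> C0"
  shows "cmod (f x) \<le> norm (\<rho> f)"
proof (rule ccontr)
  assume "\<not> ?thesis"
  then obtain c where c: "norm (\<rho> f) < c" "c < cmod (f x)"
    using dense not_le by blast
  then have "0 < c"
    using norm_ge_zero order.strict_trans1 by blast
  define t where "t y = max 0 ((cmod (f y))\<^sup>2 - c\<^sup>2)" for y
  define g where "g y = complex_of_real (t y)" for y
  \<comment> \<open>\<open>k\<close> is \<open>t\<close> to the power 3/2: where \<open>t\<close> is
    nonzero, |f|^2 = c^2 + t, so |f g|^2 = c^2 t^2 + t^3 and the last term is |k|^2.\<close>
  define k where "k y = complex_of_real (t y * sqrt (t y))" for y
  have g: "g \<in> C0"
    unfolding g_def t_def
    by (intro C0_compose[OF f, of "\<lambda>z. complex_of_real (max 0 ((cmod z)\<^sup>2 - c\<^sup>2))"] continuous_intros) auto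
  have k: "k \<in> C0"
    unfolding k_def t_def
    by (intro C0_compose[OF f, of "\<lambda>z. complex_of_real (max 0 ((cmod z)\<^sup>2 - c\<^sup>2) * sqrt (max 0 ((cmod z)\<^sup>2 - c\<^sup>2)))"]
        continuous_intros) auto
  have "c\<^sup>2 < (cmod (f x))\<^sup>2"
    using c(2) \<open>0 < c\<close> by (intro power_strict_mono) auto
  then have "t x \<noteq> 0"
    by (simp add: t_def)
  then have "g x \<noteq> 0"
    by (simp add: g_def)
  then have "g \<noteq> (\<lambda>_. 0)"
    by (metis (full_types))
  \<comment> \<open>Injectivity enters here: it supplies a nonzero vector in the range of
    \<open>\<rho> g\<close> on which to test \<open>\<rho> f\<close>.\<close>
  then have "\<rho> g \<noteq> 0"
    using inj_onD[OF rep_inj _ g C0_zero] rep_zero by auto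
  then obtain \<xi> where \<xi>: "\<rho> g \<xi> \<noteq> 0"
    by (metis blinfun_eqI zero_blinfun.rep_eq)
  have fg: "(\<lambda>y. f y * g y) \<in> C0"
    by (rule C0_mult[OF f g])
  have sq: "(\<lambda>x. complex_of_real ((cmod (h x))\<^sup>2)) \<in> C0" if "h \<in> C0" for h :: "'a \<Rightarrow> complex"
    by (intro C0_compose[OF that, of "\<lambda>z. complex_of_real ((cmod z)\<^sup>2)"] continuous_intros) auto
  have "(cmod (f y * g y))\<^sup>2 = c\<^sup>2 * (cmod (g y))\<^sup>2 + (cmod (k y))\<^sup>2" for y
  proof (cases "t y = 0")
    case False
    then have "(cmod (f y))\<^sup>2 = c\<^sup>2 + t y" "0 \<le> t y"
      by (auto simp: t_def max_def split: if_splits)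
    then show ?thesis
      by (simp add: norm_mult power_mult_distrib g_def k_def algebra_simps)
  qed (simp add: g_def k_def)
  then have eq: "(\<lambda>y. complex_of_real ((cmod (f y * g y))\<^sup>2))
      = (\<lambda>y. complex_of_real (c\<^sup>2) * complex_of_real ((cmod (g y))\<^sup>2) + complex_of_real ((cmod (k y))\<^sup>2))"
    by (simp only: of_real_add of_real_mult)
  have "\<rho> f (\<rho> g \<xi>) = \<rho> (\<lambda>y. f y * g y) \<xi>"
    by (simp add: rep_mult f g)
  then have "(norm (\<rho> f (\<rho> g \<xi>)))\<^sup>2 = c\<^sup>2 * (norm (\<rho> g \<xi>))\<^sup>2 + (norm (\<rho> k \<xi>))\<^sup>2"
    using norm_rep_square[OF fg, of \<xi>]
    by (simp only: eq rep_add[OF C0_scale[OF sq[OF g]] sq[OF k]] blinfun.add_left rep_scale[OF sq[OF g]]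
        cinner_add_left cinner_scaleC_left norm_rep_square[OF g] norm_rep_square[OF k]) simp
  then have "(c * norm (\<rho> g \<xi>))\<^sup>2 \<le> (norm (\<rho> f (\<rho> g \<xi>)))\<^sup>2"
    by (simp add: power_mult_distrib)
  then have "c * norm (\<rho> g \<xi>) \<le> norm (\<rho> f (\<rho> g \<xi>))"
    by (rule power2_le_imp_le) simp
  also have "\<dots> \<le> norm (\<rho> f) * norm (\<rho> g \<xi>)"
    by (rule norm_blinfun)
  also have "\<dots> < c * norm (\<rho> g \<xi>)"
    using c(1) \<xi> by simp
  finally show False
    by simp
qed

end

section \<open>Operators on square summable sequences\<close>

lemma ell2_nth_Abs_ell2: "summable (\<lambda>k. (norm (x k))\<^sup>2) \<Longrightarrow> ell2_nth (Abs_ell2 x) = x"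
  by (simp add: Abs_ell2_inverse)

lemma ell2_nth_add: "ell2_nth (x + y) m = ell2_nth x m + ell2_nth y m"
  by (simp add: plus_ell2.rep_eq)

lemma ell2_nth_scaleR: "ell2_nth (r *\<^sub>R x) m = r *\<^sub>R ell2_nth x m"
  by (simp add: scaleR_ell2.rep_eq)

lemma bounded_linear_ell2_nth: "bounded_linear (\<lambda>x. ell2_nth x m)"
  by (rule bounded_linear_intro[where K = 1])
    (simp_all add: ell2_nth_add ell2_nth_scaleR norm_ell2_nth_le)

lemma sum_norm_square_le: "(\<Sum>k<N. (norm (ell2_nth x k))\<^sup>2) \<le> (norm x)\<^sup>2"
  using L2_set_le_norm_ell2[of x N] by (simp add: L2_set_le_iff)

lemma norm_ell2_le:
  "0 \<le> B \<Longrightarrow> (\<And>N. (\<Sum>k<N. (norm (ell2_nth x k))\<^sup>2) \<le> B\<^sup>2) \<Longrightarrow> norm x \<le> B"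
  by (simp add: norm_ell2_le_iff L2_set_le_iff)

text \<open>One bound on finite sums gives both square summability and boundedness. Only then do
  \<open>Abs_ell2\<close> and \<open>Blinfun\<close>, unspecified outside their domains, return the
  intended entries.\<close>

lemma Blinfun_ell2:
  fixes T :: "'h::chilbert_space ell2 \<Rightarrow> nat \<Rightarrow> 'h"
  assumes add: "\<And>x y m. T (x + y) m = T x m + T y m"
    and scaleR: "\<And>r x m. T (r *\<^sub>R x) m = r *\<^sub>R T x m"
    and bound: "\<And>x N. (\<Sum>m<N. (norm (T x m))\<^sup>2) \<le> (B * norm x)\<^sup>2" and "0 \<le> B"
  shows "ell2_nth (Blinfun (\<lambda>x. Abs_ell2 (T x)) x) m = T x m"
    and "norm (Blinfun (\<lambda>x. Abs_ell2 (T x))) \<le> B"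
proof -
  have "summable (\<lambda>m. (norm (T x m))\<^sup>2)" for x
    by (rule summableI_nonneg_bounded[OF _ bound]) simp
  then have nth: "ell2_nth (Abs_ell2 (T x)) = T x" for x
    by (rule ell2_nth_Abs_ell2)
  have bd: "norm (Abs_ell2 (T x)) \<le> B * norm x" for x
    using \<open>0 \<le> B\<close> bound by (intro norm_ell2_le) (simp_all add: nth)
  have "bounded_linear (\<lambda>x. Abs_ell2 (T x))"
  proof (rule bounded_linear_intro[where K = B])
    show "Abs_ell2 (T (x + y)) = Abs_ell2 (T x) + Abs_ell2 (T y)" for x y
      by (rule ell2_eqI) (simp add: nth ell2_nth_add add)
    show "Abs_ell2 (T (r *\<^sub>R x)) = r *\<^sub>R Abs_ell2 (T x)" for r x
      by (rule ell2_eqI) (simp add: nth ell2_nth_scaleR scaleR)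
  qed (use bd in \<open>simp add: mult.commute\<close>)
  then have *: "blinfun_apply (Blinfun (\<lambda>x. Abs_ell2 (T x))) = (\<lambda>x. Abs_ell2 (T x))"
    by (rule bounded_linear_Blinfun_apply)
  show "ell2_nth (Blinfun (\<lambda>x. Abs_ell2 (T x)) x) m = T x m"
    by (simp add: * nth)
  show "norm (Blinfun (\<lambda>x. Abs_ell2 (T x))) \<le> B"
    by (rule norm_blinfun_bound[OF \<open>0 \<le> B\<close>]) (simp add: * bd)
qed

definition ell2_restrict :: "nat set \<Rightarrow> 'h::chilbert_space ell2 \<Rightarrow> 'h ell2" where
  "ell2_restrict S x = Abs_ell2 (\<lambda>k. if k \<in> S then ell2_nth x k else 0)"

lemma ell2_nth_restrict: "ell2_nth (ell2_restrict S x) k = (if k \<in> S then ell2_nth x k else 0)"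
proof -
  have "summable (\<lambda>k. (norm (if k \<in> S then ell2_nth x k else 0))\<^sup>2)"
    by (rule summable_comparison_test'[OF ell2_summable[of x]]) auto
  then show ?thesis
    by (simp add: ell2_restrict_def ell2_nth_Abs_ell2)
qed

lemma norm_restrict_le:
  assumes "finite S"
  shows "(norm (ell2_restrict S x))\<^sup>2 \<le> (\<Sum>k\<in>S. (norm (ell2_nth x k))\<^sup>2)"
proof -
  have nonneg: "0 \<le> (\<Sum>k\<in>S. (norm (ell2_nth x k))\<^sup>2)"
    by (simp add: sum_nonneg)
  have "(\<Sum>k<N. (norm (ell2_nth (ell2_restrict S x) k))\<^sup>2) \<le> (\<Sum>k\<in>S. (norm (ell2_nth x k))\<^sup>2)" for N
  proof -
    have "(\<Sum>k<N. (norm (ell2_nth (ell2_restrict S x) k))\<^sup>2)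
        = (\<Sum>k\<in>{..<N} \<inter> S. (norm (ell2_nth x k))\<^sup>2)"
      unfolding sum.inter_restrict[OF finite_lessThan]
      by (intro sum.cong) (auto simp: ell2_nth_restrict)
    also have "\<dots> \<le> (\<Sum>k\<in>S. (norm (ell2_nth x k))\<^sup>2)"
      by (intro sum_mono2 assms) auto
    finally show ?thesis .
  qed
  then have "norm (ell2_restrict S x) \<le> sqrt (\<Sum>k\<in>S. (norm (ell2_nth x k))\<^sup>2)"
    using nonneg by (intro norm_ell2_le) simp_all
  then show ?thesis
    by (rule sqrt_ge_absD[OF order_trans[OF eq_refl[OF abs_norm_cancel]]])
qed

text \<open>The elementary tensor with e_0. It extracts column 0, which carries the power
  \<open>\<phi> ^^ 0\<close> and so shows the coefficients themselves.\<close>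

definition ell2_single :: "'h::chilbert_space \<Rightarrow> 'h ell2" where
  "ell2_single \<xi> = Abs_ell2 (\<lambda>k. if k = 0 then \<xi> else 0)"

lemma ell2_nth_single: "ell2_nth (ell2_single \<xi>) k = (if k = 0 then \<xi> else 0)"
proof -
  have "summable (\<lambda>k. (norm (if k = 0 then \<xi> else 0))\<^sup>2)"
    by (rule summable_finite[of "{0}"]) auto
  then show ?thesis
    by (simp add: ell2_single_def ell2_nth_Abs_ell2)
qed

lemma norm_ell2_single: "norm (ell2_single \<xi>) \<le> norm \<xi>"
proof (rule norm_ell2_le)
  fix N
  have "(\<Sum>k<N. (norm (ell2_nth (ell2_single \<xi>) k))\<^sup>2) = (\<Sum>k<N. if k = 0 then (norm \<xi>)\<^sup>2 else 0)"
    by (intro sum.cong) (auto simp: ell2_nth_single)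
  also have "\<dots> \<le> (norm \<xi>)\<^sup>2"
    by (simp add: sum.delta)
  finally show "(\<Sum>k<N. (norm (ell2_nth (ell2_single \<xi>) k))\<^sup>2) \<le> (norm \<xi>)\<^sup>2" .
qed simp

section \<open>Composition with powers of \<open>\<phi>\<close>, and monomials as operator-weighted
  shifts\<close>

locale proper_dynamics =
  fixes \<phi> :: "'a::t2_space \<Rightarrow> 'a"
    and \<rho> :: "('a \<Rightarrow> complex) \<Rightarrow> 'h::chilbert_space \<Rightarrow>\<^sub>L 'h"
  assumes continuous: "continuous_on UNIV \<phi>"
    and proper: "\<And>K. compact K \<Longrightarrow> compact (\<phi> -` K)"
    and rep: "faithful_star_rep \<rho>"
begin

lemma continuous_funpow: "continuous_on UNIV (\<phi> ^^ k)"
proof (induction k)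
  case (Suc k)
  then show ?case
    using continuous_on_compose2[OF continuous Suc] by (simp add: comp_def)
qed (simp add: id_def)

lemma compact_vimage_funpow: "compact K \<Longrightarrow> compact ((\<phi> ^^ k) -` K)"
proof (induction k arbitrary: K)
  case (Suc k)
  have "(\<phi> ^^ Suc k) -` K = (\<phi> ^^ k) -` (\<phi> -` K)"
    by auto
  then show ?case
    using Suc.IH[OF proper[OF Suc.prems]] by (simp only:)
qed simp

lemma C0_funpow:
  assumes "f \<in> C0"
  shows "f \<circ> \<phi> ^^ k \<in> C0"
proof (rule C0_I)
  show "continuous_on UNIV (f \<circ> \<phi> ^^ k)"
    unfolding comp_def
    by (rule continuous_on_compose2[OF C0_continuous[OF assms] continuous_funpow]) simp
  fix e :: real
  assume "0 < e"
  then show "\<exists>K. compact K \<and> (\<forall>x. e \<le> cmod ((f \<circ> \<phi> ^^ k) x) \<longrightarrow> x \<in> K)"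
    using compact_vimage_funpow[OF C0_compact[OF assms], of e k]
    by (intro exI[of _ "(\<phi> ^^ k) -` {x. e \<le> cmod (f x)}"]) simp
qed

lemma norm_rep_funpow_le: "f \<in> C0 \<Longrightarrow> (\<And>x. cmod (f x) \<le> M) \<Longrightarrow> norm (\<rho> (f \<circ> \<phi> ^^ k)) \<le> M"
  by (rule norm_rep_le[OF rep C0_funpow]) simp_all

lemma rep_funpow_diff:
  "f \<in> C0 \<Longrightarrow> g \<in> C0 \<Longrightarrow> \<rho> ((\<lambda>x. f x - g x) \<circ> \<phi> ^^ k) = \<rho> (f \<circ> \<phi> ^^ k) - \<rho> (g \<circ> \<phi> ^^ k)"
  using rep_diff[OF rep C0_funpow C0_funpow] by (simp add: comp_def)

lemma rep_funpow_add:
  "f \<in> C0 \<Longrightarrow> g \<in> C0 \<Longrightarrow> \<rho> ((\<lambda>x. f x + g x) \<circ> \<phi> ^^ k) = \<rho> (f \<circ> \<phi> ^^ k) + \<rho> (g \<circ> \<phi> ^^ k)"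
  using rep_add[OF rep C0_funpow C0_funpow] by (simp add: comp_def)

lemma rep_funpow_scaleR:
  "f \<in> C0 \<Longrightarrow> \<rho> ((\<lambda>x. complex_of_real r * f x) \<circ> \<phi> ^^ k) = r *\<^sub>R \<rho> (f \<circ> \<phi> ^^ k)"
  using rep_scaleR[OF rep C0_funpow] by (simp add: comp_def)

lemma
  assumes f: "f \<in> C0"
  shows ell2_nth_pi_mono: "ell2_nth (pi_mono \<rho> \<phi> n f x) m
      = (if m < n then 0 else \<rho> (f \<circ> \<phi> ^^ (m - n)) (ell2_nth x (m - n)))"
    and norm_pi_mono_le: "norm (pi_mono \<rho> \<phi> n f) \<le> sup_norm f"
proof -
  let ?T = "\<lambda>x m. if m < n then 0 else \<rho> (f \<circ> \<phi> ^^ (m - n)) (ell2_nth x (m - n))"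
  have "(\<Sum>m<N. (norm (?T x m))\<^sup>2) \<le> (sup_norm f * norm x)\<^sup>2" for x N
  proof -
    have "(\<Sum>m<N. (norm (?T x m))\<^sup>2) = (\<Sum>m\<in>{n..<N}. (norm (?T x m))\<^sup>2)"
      by (rule sum.mono_neutral_right) auto
    also have "\<dots> \<le> (\<Sum>m\<in>{n..<N}. (sup_norm f)\<^sup>2 * (norm (ell2_nth x (m - n)))\<^sup>2)"
    proof (rule sum_mono)
      fix m assume "m \<in> {n..<N}"
      then have "norm (?T x m) \<le> sup_norm f * norm (ell2_nth x (m - n))"
        using norm_rep_apply_le[OF rep C0_funpow[OF f]] norm_le_sup_norm[OF f] by simp
      then have "(norm (?T x m))\<^sup>2 \<le> (sup_norm f * norm (ell2_nth x (m - n)))\<^sup>2"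
        by (intro power_mono) auto
      then show "(norm (?T x m))\<^sup>2 \<le> (sup_norm f)\<^sup>2 * (norm (ell2_nth x (m - n)))\<^sup>2"
        by (simp add: power_mult_distrib)
    qed
    also have "\<dots> = (sup_norm f)\<^sup>2 * (\<Sum>k<N - n. (norm (ell2_nth x k))\<^sup>2)"
      unfolding sum_distrib_left
      by (rule sum.reindex_bij_witness[of _ "\<lambda>k. k + n" "\<lambda>m. m - n"]) auto
    also have "\<dots> \<le> (sup_norm f)\<^sup>2 * (norm x)\<^sup>2"
      by (intro mult_left_mono sum_norm_square_le) simp
    finally show ?thesis
      by (simp add: power_mult_distrib)
  qed
  note * = Blinfun_ell2[of ?T, OF _ _ this sup_norm_nonneg[OF f]]
  show "ell2_nth (pi_mono \<rho> \<phi> n f x) m = ?T x m" "norm (pi_mono \<rho> \<phi> n f) \<le> sup_norm f"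
    unfolding pi_mono_def
    by (rule *; simp add: ell2_nth_add ell2_nth_scaleR blinfun.add_right blinfun.scaleR_right)+
qed

section \<open>Fourier coefficients\<close>

text \<open>Entry \<open>(m, j)\<close> of the matrix of \<open>A\<close> is \<open>\<rho> (c (m - j) \<circ> \<phi>\<^sup>j)\<close>: \<open>A\<close> has the formal
  series \<open>\<Sum> U\<^sup>n (c n)\<close>.\<close>

definition has_coeffs :: "('h ell2 \<Rightarrow>\<^sub>L 'h ell2) \<Rightarrow> (nat \<Rightarrow> 'a \<Rightarrow> complex) \<Rightarrow> bool" where
  "has_coeffs A c \<longleftrightarrow> (\<forall>n. c n \<in> C0) \<and>
     (\<forall>x m. ell2_nth (A x) m = (\<Sum>j\<le>m. \<rho> (c (m - j) \<circ> \<phi> ^^ j) (ell2_nth x j)))"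

lemma has_coeffs_C0: "has_coeffs A c \<Longrightarrow> c n \<in> C0"
  by (simp add: has_coeffs_def)

lemma has_coeffs_nth:
  "has_coeffs A c \<Longrightarrow> ell2_nth (A x) m = (\<Sum>j\<le>m. \<rho> (c (m - j) \<circ> \<phi> ^^ j) (ell2_nth x j))"
  by (simp add: has_coeffs_def)

lemma has_coeffs_pi_mono:
  assumes f: "f \<in> C0"
  shows "has_coeffs (pi_mono \<rho> \<phi> n f) (\<lambda>k. if k = n then f else (\<lambda>_. 0))"
proof -
  have "(\<Sum>j\<le>m. \<rho> ((if m - j = n then f else (\<lambda>_. 0)) \<circ> \<phi> ^^ j) (ell2_nth x j))
      = ell2_nth (pi_mono \<rho> \<phi> n f x) m" for x m
  proof -
    \<comment> \<open>The condition \<open>n \<le> m\<close> guards against truncated subtraction: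
      for \<open>n > m\<close> the index \<open>m - n\<close> is 0, although no \<open>j\<close>
      satisfies \<open>m - j = n\<close>.\<close>
    have "(\<Sum>j\<le>m. \<rho> ((if m - j = n then f else (\<lambda>_. 0)) \<circ> \<phi> ^^ j) (ell2_nth x j))
        = (\<Sum>j\<le>m. if j = m - n \<and> n \<le> m then \<rho> (f \<circ> \<phi> ^^ j) (ell2_nth x j) else 0)"
      by (intro sum.cong) (auto simp: comp_def rep_zero[OF rep])
    also have "\<dots> = ell2_nth (pi_mono \<rho> \<phi> n f x) m"
      by (cases "n \<le> m") (simp_all add: ell2_nth_pi_mono[OF f] sum.delta)
    finally show ?thesis .
  qed
  then show ?thesis
    by (simp add: has_coeffs_def f C0_zero)
qed

lemma has_coeffs_zero: "has_coeffs 0 (\<lambda>_ _. 0)"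
  by (simp add: has_coeffs_def C0_zero comp_def rep_zero[OF rep] zero_ell2.rep_eq)

lemma has_coeffs_add:
  "has_coeffs A c \<Longrightarrow> has_coeffs B d \<Longrightarrow> has_coeffs (A + B) (\<lambda>n x. c n x + d n x)"
  by (simp add: has_coeffs_def C0_add blinfun.add_left ell2_nth_add rep_funpow_add sum.distrib)

lemma has_coeffs_diff:
  "has_coeffs A c \<Longrightarrow> has_coeffs B d \<Longrightarrow> has_coeffs (A - B) (\<lambda>n x. c n x - d n x)"
  by (simp add: has_coeffs_def C0_diff blinfun.diff_left minus_ell2.rep_eq rep_funpow_diff sum_subtractf)

lemma has_coeffs_unique_op:
  assumes "has_coeffs A c" "has_coeffs B c"
  shows "A = B"
  by (intro blinfun_eqI ell2_eqI) (simp add: has_coeffs_nth[OF assms(1)] has_coeffs_nth[OF assms(2)])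

lemma ell2_nth_apply_single:
  assumes "has_coeffs A c"
  shows "ell2_nth (A (ell2_single \<xi>)) n = \<rho> (c n) \<xi>"
proof -
  have "ell2_nth (A (ell2_single \<xi>)) n
      = (\<Sum>j\<le>n. if j = 0 then \<rho> (c (n - j) \<circ> \<phi> ^^ j) \<xi> else 0)"
    unfolding has_coeffs_nth[OF assms] by (intro sum.cong) (auto simp: ell2_nth_single)
  then show ?thesis
    by (simp add: sum.delta comp_def)
qed

text \<open>A matrix entry is a compression, so \<open>\<rho> f\<close> has norm at most that of
  \<open>A\<close>, and \<open>\<rho>\<close> is isometric. Asking for a single entry makes this
  applicable to products whose other coefficients are not computed.\<close>

lemma norm_le_if_entries:
  fixes A :: "'h ell2 \<Rightarrow>\<^sub>L 'h ell2"
  assumes f: "f \<in> C0" and entry: "\<And>\<xi>. ell2_nth (A (ell2_single \<xi>)) n = \<rho> f \<xi>"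
  shows "cmod (f x) \<le> norm A"
proof -
  have "norm (\<rho> f \<xi>) \<le> norm A * norm \<xi>" for \<xi>
  proof -
    have "norm (\<rho> f \<xi>) \<le> norm (A (ell2_single \<xi>))"
      unfolding entry[symmetric] by (rule norm_ell2_nth_le)
    also have "\<dots> \<le> norm A * norm (ell2_single \<xi>)"
      by (rule norm_blinfun)
    also have "\<dots> \<le> norm A * norm \<xi>"
      by (intro mult_left_mono norm_ell2_single) simp
    finally show ?thesis .
  qed
  then have "norm (\<rho> f) \<le> norm A"
    by (intro norm_blinfun_bound) auto
  then show ?thesis
    using norm_le_norm_rep[OF rep f] order_trans by blast
qed

lemma norm_coeff_le:
  assumes "has_coeffs A c"
  shows "cmod (c n x) \<le> norm A"
  by (rule norm_le_if_entries[OF has_coeffs_C0[OF assms] ell2_nth_apply_single[OF assms]])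

lemma has_coeffs_unique:
  assumes "has_coeffs A c" "has_coeffs A d"
  shows "c = d"
proof (intro ext)
  fix n x
  show "c n x = d n x"
    using norm_coeff_le[OF has_coeffs_diff[OF assms], of n x] by simp
qed

lemma rep_funpow_tendsto:
  assumes "\<And>i. f i \<in> C0" "g \<in> C0" "uniform_limit UNIV f g sequentially"
  shows "(\<lambda>i. \<rho> (f i \<circ> \<phi> ^^ k)) \<longlonglongrightarrow> \<rho> (g \<circ> \<phi> ^^ k)"
proof (rule metric_LIMSEQ_I)
  fix e :: real
  assume "0 < e"
  then have "\<forall>\<^sub>F i in sequentially. \<forall>x\<in>UNIV. dist (f i x) (g x) < e / 2"
    by (intro uniform_limitD[OF assms(3)]) simp
  then obtain M where M: "\<And>i x. M \<le> i \<Longrightarrow> cmod (f i x - g x) < e / 2"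
    by (auto simp: dist_norm eventually_sequentially)
  have "dist (\<rho> (f i \<circ> \<phi> ^^ k)) (\<rho> (g \<circ> \<phi> ^^ k)) < e" if "M \<le> i" for i
  proof -
    have "norm (\<rho> ((\<lambda>x. f i x - g x) \<circ> \<phi> ^^ k)) \<le> e / 2"
      by (intro norm_rep_funpow_le C0_diff assms less_imp_le M that)
    then show ?thesis
      using \<open>0 < e\<close> by (simp add: rep_funpow_diff assms dist_norm)
  qed
  then show "\<exists>M. \<forall>i\<ge>M. dist (\<rho> (f i \<circ> \<phi> ^^ k)) (\<rho> (g \<circ> \<phi> ^^ k)) < e"
    by blast
qed

lemma ell2_nth_apply_tendsto:
  assumes "A \<longlonglongrightarrow> L"
  shows "(\<lambda>i. ell2_nth (blinfun_apply (A i) x) m) \<longlonglongrightarrow> ell2_nth (blinfun_apply L x) m"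
  by (intro bounded_linear.tendsto[OF bounded_linear_ell2_nth] blinfun.tendsto assms tendsto_const)

text \<open>By \<open>norm_coeff_le\<close> the coefficients of a convergent sequence of operators
  are uniformly Cauchy. Each matrix row involves finitely many of them, so the entry formula
  survives the limit.\<close>

lemma has_coeffs_limit:
  assumes A: "\<And>i. has_coeffs (A i) (c i)" and lim: "A \<longlonglongrightarrow> L"
  obtains d where "has_coeffs L d"
proof -
  have "\<exists>d. d \<in> C0 \<and> uniform_limit UNIV (\<lambda>i. c i n) d sequentially" for n
  proof -
    have cauchy: "\<exists>M. \<forall>i\<ge>M. \<forall>j\<ge>M. \<forall>x. cmod (c i n x - c j n x) < e" if "0 < e" for e
    proof -
      obtain M where "\<And>i j. M \<le> i \<Longrightarrow> M \<le> j \<Longrightarrow> norm (A i - A j) < e"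
        using metric_CauchyD[OF LIMSEQ_imp_Cauchy[OF lim] \<open>0 < e\<close>] by (auto simp: dist_norm)
      then show ?thesis
        using norm_coeff_le[OF has_coeffs_diff[OF A A]] by (meson order.strict_trans1)
    qed
    show ?thesis
      by (rule C0_Cauchy_limit[of "\<lambda>i. c i n", OF has_coeffs_C0[OF A] cauchy]) auto
  qed
  then have "\<forall>n. \<exists>d. d \<in> C0 \<and> uniform_limit UNIV (\<lambda>i. c i n) d sequentially" ..
  from choice[OF this] obtain d
    where "\<forall>n. d n \<in> C0 \<and> uniform_limit UNIV (\<lambda>i. c i n) (d n) sequentially" ..
  then have d: "d n \<in> C0" "uniform_limit UNIV (\<lambda>i. c i n) (d n) sequentially" for n
    by simp_all
  have "ell2_nth (L x) m = (\<Sum>j\<le>m. \<rho> (d (m - j) \<circ> \<phi> ^^ j) (ell2_nth x j))" for x m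
  proof (rule LIMSEQ_unique[OF ell2_nth_apply_tendsto[OF lim]])
    show "(\<lambda>i. ell2_nth (A i x) m) \<longlonglongrightarrow> (\<Sum>j\<le>m. \<rho> (d (m - j) \<circ> \<phi> ^^ j) (ell2_nth x j))"
      unfolding has_coeffs_nth[OF A]
      by (intro tendsto_sum blinfun.tendsto rep_funpow_tendsto has_coeffs_C0[OF A] d tendsto_const)
  qed
  then have "has_coeffs L d"
    using d(1) by (simp add: has_coeffs_def)
  then show ?thesis
    by (rule that)
qed

lemma has_coeffs_sum_pi_mono:
  assumes "\<And>n. F n \<in> C0"
  shows "has_coeffs (\<Sum>n<N. pi_mono \<rho> \<phi> n (F n)) (\<lambda>n. if n < N then F n else (\<lambda>_. 0))"
proof (induction N)
  case 0
  then show ?case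
    using has_coeffs_zero by simp
next
  case (Suc N)
  have "(\<lambda>n. if n < Suc N then F n else (\<lambda>_. 0))
      = (\<lambda>n x. (if n < N then F n else (\<lambda>_. 0)) x + (if n = N then F N else (\<lambda>_. 0)) x)"
    by (auto simp: fun_eq_iff)
  then show ?case
    using has_coeffs_add[OF Suc has_coeffs_pi_mono[OF assms[of N]], of N] by simp
qed

lemma pi_rep_sums:
  assumes "F \<in> l1_C0"
  shows "(\<lambda>n. pi_mono \<rho> \<phi> n (F n)) sums pi_rep \<rho> \<phi> F"
proof -
  have "summable (\<lambda>n. norm (pi_mono \<rho> \<phi> n (F n)))"
  proof (rule summable_comparison_test')
    show "summable (\<lambda>n. sup_norm (F n))"
      using assms by (simp add: l1_C0_def)
    show "norm (norm (pi_mono \<rho> \<phi> n (F n))) \<le> sup_norm (F n)" for n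
      using assms by (simp add: l1_C0_def norm_pi_mono_le)
  qed
  then show ?thesis
    unfolding pi_rep_def by (rule summable_sums[OF summable_norm_cancel])
qed

lemma has_coeffs_pi_rep:
  assumes F: "F \<in> l1_C0"
  shows "has_coeffs (pi_rep \<rho> \<phi> F) F"
proof -
  have C: "\<And>n. F n \<in> C0"
    using F by (simp add: l1_C0_def)
  have lim: "(\<lambda>N. \<Sum>n<N. pi_mono \<rho> \<phi> n (F n)) \<longlonglongrightarrow> pi_rep \<rho> \<phi> F"
    using pi_rep_sums[OF F] by (simp add: sums_def)
  have "ell2_nth (pi_rep \<rho> \<phi> F x) m = (\<Sum>j\<le>m. \<rho> (F (m - j) \<circ> \<phi> ^^ j) (ell2_nth x j))" for x m
  proof (rule LIMSEQ_unique[OF ell2_nth_apply_tendsto[OF lim]])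
    \<comment> \<open>Row \<open>m\<close> uses only coefficients of index at most \<open>m\<close>,
      so it is constant once \<open>N > m\<close>.\<close>
    have "ell2_nth ((\<Sum>n<N. pi_mono \<rho> \<phi> n (F n)) x) m
        = (\<Sum>j\<le>m. \<rho> (F (m - j) \<circ> \<phi> ^^ j) (ell2_nth x j))" if "m < N" for N
      using that unfolding has_coeffs_nth[OF has_coeffs_sum_pi_mono[OF C]]
      by (intro sum.cong) auto
    then have "\<forall>\<^sub>F N in sequentially. ell2_nth ((\<Sum>n<N. pi_mono \<rho> \<phi> n (F n)) x) m
        = (\<Sum>j\<le>m. \<rho> (F (m - j) \<circ> \<phi> ^^ j) (ell2_nth x j))"
      using eventually_gt_at_top[of m] by (rule eventually_mono[rotated])
    then show "(\<lambda>N. ell2_nth ((\<Sum>n<N. pi_mono \<rho> \<phi> n (F n)) x) m)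
        \<longlonglongrightarrow> (\<Sum>j\<le>m. \<rho> (F (m - j) \<circ> \<phi> ^^ j) (ell2_nth x j))"
      by (rule tendsto_eventually)
  qed
  then show ?thesis
    using C by (simp add: has_coeffs_def)
qed

lemma semicrossed_product_sequence:
  assumes "A \<in> semicrossed_product \<rho> \<phi>"
  obtains F where "\<And>j. F j \<in> l1_C0" "(\<lambda>j. pi_rep \<rho> \<phi> (F j)) \<longlonglongrightarrow> A"
proof -
  from assms obtain B where B: "\<And>j. B j \<in> pi_rep \<rho> \<phi> ` l1_C0" "B \<longlonglongrightarrow> A"
    unfolding semicrossed_product_def closure_sequential by blast
  then have "\<forall>j. \<exists>F. F \<in> l1_C0 \<and> B j = pi_rep \<rho> \<phi> F"
    by blast
  from choice[OF this] obtain F where F: "\<forall>j. F j \<in> l1_C0 \<and> B j = pi_rep \<rho> \<phi> (F j)" ..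
  then have "B = (\<lambda>j. pi_rep \<rho> \<phi> (F j))"
    by auto
  with B(2) F show ?thesis
    by (intro that[of F]) simp_all
qed

text \<open>This discharges the definite description: the coefficients \<open>c\<close> of the limit
  satisfy it, and one approximating sequence suffices to exclude any other candidate.\<close>

lemma has_coeffs_fourier_coeff:
  assumes A: "A \<in> semicrossed_product \<rho> \<phi>"
  shows "has_coeffs A (\<lambda>n. fourier_coeff \<rho> \<phi> n A)"
proof -
  obtain F where F: "\<And>j. F j \<in> l1_C0" "(\<lambda>j. pi_rep \<rho> \<phi> (F j)) \<longlonglongrightarrow> A"
    using semicrossed_product_sequence[OF A] by blast
  obtain c where c: "has_coeffs A c"
    using has_coeffs_limit[OF has_coeffs_pi_rep[OF F(1)] F(2)] by blast
  have conv: "(\<lambda>j. sup_norm (\<lambda>x. G j n x - c n x)) \<longlonglongrightarrow> 0"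
    if G: "\<And>j. G j \<in> l1_C0" "(\<lambda>j. pi_rep \<rho> \<phi> (G j)) \<longlonglongrightarrow> A" for G n
  proof (rule tendsto_sandwich[of "\<lambda>_. 0"])
    have "(\<lambda>x. G j n x - c n x) \<in> C0" for j
      by (intro C0_diff has_coeffs_C0[OF has_coeffs_pi_rep[OF G(1)]] has_coeffs_C0[OF c])
    then show "\<forall>\<^sub>F j in sequentially. 0 \<le> sup_norm (\<lambda>x. G j n x - c n x)"
      by (simp add: sup_norm_nonneg)
    show "\<forall>\<^sub>F j in sequentially. sup_norm (\<lambda>x. G j n x - c n x) \<le> norm (pi_rep \<rho> \<phi> (G j) - A)"
      by (intro always_eventually allI sup_norm_le
          norm_coeff_le[OF has_coeffs_diff[OF has_coeffs_pi_rep[OF G(1)] c]])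
    show "(\<lambda>j. norm (pi_rep \<rho> \<phi> (G j) - A)) \<longlonglongrightarrow> 0"
      using G(2) by (intro tendsto_norm_zero LIM_zero)
  qed simp
  have "fourier_coeff \<rho> \<phi> n A = c n" for n
    unfolding fourier_coeff_def
  proof (rule the_equality)
    show "c n \<in> C0 \<and> (\<forall>F. (\<forall>j. F j \<in> l1_C0) \<longrightarrow> (\<lambda>j. pi_rep \<rho> \<phi> (F j)) \<longlonglongrightarrow> A
        \<longrightarrow> (\<lambda>j. sup_norm (\<lambda>x. F j n x - c n x)) \<longlonglongrightarrow> 0)"
      using has_coeffs_C0[OF c] conv by blast
    fix g
    assume g: "g \<in> C0 \<and> (\<forall>F. (\<forall>j. F j \<in> l1_C0) \<longrightarrow> (\<lambda>j. pi_rep \<rho> \<phi> (F j)) \<longlonglongrightarrow> A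
        \<longrightarrow> (\<lambda>j. sup_norm (\<lambda>x. F j n x - g x)) \<longlonglongrightarrow> 0)"
    have "cmod (g x - c n x) \<le> 0" for x
    proof (rule tendsto_lowerbound)
      have "(\<lambda>j. sup_norm (\<lambda>x. F j n x - g x)) \<longlonglongrightarrow> 0"
        using g F by blast
      from tendsto_add[OF this conv[OF F]]
      show "(\<lambda>j. sup_norm (\<lambda>x. F j n x - g x) + sup_norm (\<lambda>x. F j n x - c n x)) \<longlonglongrightarrow> 0"
        by simp
      have "cmod (g x - c n x) \<le> sup_norm (\<lambda>x. F j n x - g x) + sup_norm (\<lambda>x. F j n x - c n x)" for j
      proof -
        have C: "F j n \<in> C0"
          by (rule has_coeffs_C0[OF has_coeffs_pi_rep[OF F(1)]])
        have "cmod (g x - c n x) \<le> cmod (F j n x - g x) + cmod (F j n x - c n x)"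
          using norm_triangle_ineq4[of "F j n x - c n x" "F j n x - g x"] by simp
        then show ?thesis
          using norm_le_sup_norm[OF C0_diff[OF C conjunct1[OF g]], of x]
            norm_le_sup_norm[OF C0_diff[OF C has_coeffs_C0[OF c]], of x n] by linarith
      qed
      then show "\<forall>\<^sub>F j in sequentially.
          cmod (g x - c n x) \<le> sup_norm (\<lambda>x. F j n x - g x) + sup_norm (\<lambda>x. F j n x - c n x)"
        by simp
    qed simp
    then show "g = c n"
      by (auto simp: fun_eq_iff)
  qed
  then show ?thesis
    using c by simp
qed

lemma sum_pi_mono_in_semicrossed_product:
  assumes "\<And>n. F n \<in> C0"
  shows "(\<Sum>n<N. pi_mono \<rho> \<phi> n (F n)) \<in> semicrossed_product \<rho> \<phi>"
proof -
  let ?G = "\<lambda>n. if n < N then F n else (\<lambda>_. 0)"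
  have "summable (\<lambda>n. sup_norm (?G n))"
    by (rule summable_finite[of "{..<N}"]) (auto simp: sup_norm_def)
  then have G: "?G \<in> l1_C0"
    using assms by (simp add: l1_C0_def C0_zero)
  have "(\<Sum>n<N. pi_mono \<rho> \<phi> n (F n)) = pi_rep \<rho> \<phi> ?G"
    by (rule has_coeffs_unique_op[OF has_coeffs_sum_pi_mono[OF assms] has_coeffs_pi_rep[OF G]])
  moreover have "pi_rep \<rho> \<phi> ?G \<in> semicrossed_product \<rho> \<phi>"
    unfolding semicrossed_product_def by (rule subsetD[OF closure_subset imageI[OF G]])
  ultimately show ?thesis
    by simp
qed

lemma pi_mono_scaleR:
  assumes "f \<in> C0"
  shows "pi_mono \<rho> \<phi> n (\<lambda>x. complex_of_real r * f x) = r *\<^sub>R pi_mono \<rho> \<phi> n f"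
  by (intro blinfun_eqI ell2_eqI)
    (simp add: ell2_nth_pi_mono assms C0_scale blinfun.scaleR_left ell2_nth_scaleR rep_funpow_scaleR)

lemma pi_mono_diff:
  assumes "f \<in> C0" "g \<in> C0"
  shows "pi_mono \<rho> \<phi> n (\<lambda>x. f x - g x) = pi_mono \<rho> \<phi> n f - pi_mono \<rho> \<phi> n g"
  by (intro blinfun_eqI ell2_eqI)
    (simp add: ell2_nth_pi_mono assms C0_diff blinfun.diff_left minus_ell2.rep_eq rep_funpow_diff)

text \<open>Moving a function past U^n composes it with \<open>\<phi> ^^ n\<close>. In row
  \<open>m\<close> this comes down to \<open>\<phi> ^^ n\<close> after
  \<open>\<phi> ^^ (m - n)\<close> being \<open>\<phi> ^^ m\<close>.\<close>

lemma pi_mono_compose: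
  assumes e: "e \<in> C0" and f: "f \<in> C0"
  shows "pi_mono \<rho> \<phi> 0 e o\<^sub>L pi_mono \<rho> \<phi> n f = pi_mono \<rho> \<phi> n (\<lambda>x. e ((\<phi> ^^ n) x) * f x)"
proof (intro blinfun_eqI ell2_eqI)
  fix x m
  have ef: "(\<lambda>x. e ((\<phi> ^^ n) x) * f x) \<in> C0"
    using C0_mult[OF C0_funpow[OF e] f] by (simp add: comp_def)
  show "ell2_nth ((pi_mono \<rho> \<phi> 0 e o\<^sub>L pi_mono \<rho> \<phi> n f) x) m
      = ell2_nth (pi_mono \<rho> \<phi> n (\<lambda>x. e ((\<phi> ^^ n) x) * f x) x) m"
  proof (cases "m < n")
    case False
    then have "(\<phi> ^^ n) ((\<phi> ^^ (m - n)) y) = (\<phi> ^^ m) y" for y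
      by (metis comp_apply funpow_add le_add_diff_inverse not_less)
    then have "(\<lambda>x. e ((\<phi> ^^ n) x) * f x) \<circ> \<phi> ^^ (m - n)
        = (\<lambda>x. (e \<circ> \<phi> ^^ m) x * (f \<circ> \<phi> ^^ (m - n)) x)"
      by (simp add: fun_eq_iff)
    then show ?thesis
      using False rep_mult[OF rep C0_funpow[OF e] C0_funpow[OF f]]
      by (simp add: ell2_nth_pi_mono[OF e] ell2_nth_pi_mono[OF f] ell2_nth_pi_mono[OF ef])
  qed (simp add: ell2_nth_pi_mono[OF e] ell2_nth_pi_mono[OF f] ell2_nth_pi_mono[OF ef])
qed

section \<open>Cesaro means\<close>

text \<open>The Fejer multiplier is the average of the compressions of \<open>A\<close> to the windows
  \<open>{j. j \<le> s < j + N}\<close>, since positions \<open>j \<le> m\<close> lie in exactly \<open>N - (m - j)\<close> common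
  windows (truncated subtraction).\<close>

lemma norm_cesaro_le:
  assumes A: "has_coeffs A c" and "0 < N"
    and S: "has_coeffs S (\<lambda>k x. complex_of_real (real (N - k) / real N) * c k x)"
  shows "norm S \<le> norm A"
proof (rule norm_blinfun_bound)
  fix x :: "'h ell2"
  define P where "P s = ell2_restrict {j. j \<le> s \<and> s < j + N} x" for s
  define a where "a s m = norm (ell2_nth (A (P s)) m)" for s m
  have avg: "ell2_nth (S x) m = (1 / real N) *\<^sub>R (\<Sum>s\<in>{m..<m + N}. ell2_nth (A (P s)) m)" for m
  proof -
    define v where "v j = \<rho> (c (m - j) \<circ> \<phi> ^^ j) (ell2_nth x j)" for j
    \<comment> \<open>For \<open>j \<le> m \<le> s\<close> the lower window condition
      \<open>j \<le> s\<close> is automatic, so only \<open>s < j + N\<close> remains.\<close>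
    have "(\<Sum>s\<in>{m..<m + N}. ell2_nth (A (P s)) m)
        = (\<Sum>s\<in>{m..<m + N}. \<Sum>j\<le>m. if s < j + N then v j else 0)"
      unfolding has_coeffs_nth[OF A] P_def v_def
      by (intro sum.cong) (auto simp: ell2_nth_restrict)
    also have "\<dots> = (\<Sum>j\<le>m. \<Sum>s\<in>{m..<m + N}. if s < j + N then v j else 0)"
      by (rule sum.swap)
    also have "\<dots> = (\<Sum>j\<le>m. real (N - (m - j)) *\<^sub>R v j)"
    proof (rule sum.cong)
      fix j assume "j \<in> {..m}"
      then have "{m..<m + N} \<inter> {s. s < j + N} = {m..<j + N}" "N - (m - j) = j + N - m"
        by auto
      then show "(\<Sum>s\<in>{m..<m + N}. if s < j + N then v j else 0) = real (N - (m - j)) *\<^sub>R v j"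
        by (simp add: sum.If_cases sum_constant_scaleR)
    qed simp
    finally show ?thesis
      unfolding has_coeffs_nth[OF S] v_def rep_funpow_scaleR[OF has_coeffs_C0[OF A]]
      by (simp add: blinfun.scaleR_left scaleR_sum_right)
  qed
  have entry: "(norm (ell2_nth (S x) m))\<^sup>2 \<le> (1 / real N) * (\<Sum>s\<in>{m..<m + N}. (a s m)\<^sup>2)" for m
  proof -
    have "norm (ell2_nth (S x) m) \<le> (1 / real N) * (\<Sum>s\<in>{m..<m + N}. a s m)"
      unfolding avg a_def by (simp add: divide_right_mono norm_sum)
    then have "(norm (ell2_nth (S x) m))\<^sup>2 \<le> (1 / real N)\<^sup>2 * (\<Sum>s\<in>{m..<m + N}. a s m)\<^sup>2"
      unfolding power_mult_distrib[symmetric] by (intro power_mono) simp_all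
    \<comment> \<open>Cauchy-Schwarz over \<open>N\<close> windows: the square of an average is at
      most the average of the squares.\<close>
    also have "\<dots> \<le> (1 / real N)\<^sup>2 * ((\<Sum>s\<in>{m..<m + N}. (a s m)\<^sup>2) * real N)"
      using Cauchy_Schwarz_ineq_sum[of "\<lambda>s. a s m" "\<lambda>_. 1" "{m..<m + N}"]
      by (intro mult_left_mono) simp_all
    also have "\<dots> = (1 / real N) * (\<Sum>s\<in>{m..<m + N}. (a s m)\<^sup>2)"
      using \<open>0 < N\<close> by (simp add: power2_eq_square field_simps)
    finally show ?thesis .
  qed
  show "norm (S x) \<le> norm A * norm x"
  proof (rule norm_ell2_le)
    fix M
    \<comment> \<open>For \<open>m < M\<close> the range of \<open>s\<close> is enlarged to one
      independent of \<open>m\<close>, so that the two sums can be exchanged and each window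
      estimated by \<open>norm A\<close>.\<close>
    have "(\<Sum>m<M. (norm (ell2_nth (S x) m))\<^sup>2)
        \<le> (\<Sum>m<M. (1 / real N) * (\<Sum>s<M + N. (a s m)\<^sup>2))"
      by (intro sum_mono order_trans[OF entry] mult_left_mono sum_mono2) auto
    also have "\<dots> = (1 / real N) * (\<Sum>s<M + N. \<Sum>m<M. (a s m)\<^sup>2)"
      unfolding sum_distrib_left[symmetric] by (subst sum.swap) simp
    also have "\<dots> \<le> (1 / real N) * (\<Sum>s<M + N. (norm A)\<^sup>2 * (norm (P s))\<^sup>2)"
    proof (intro mult_left_mono sum_mono)
      fix s
      have "(\<Sum>m<M. (a s m)\<^sup>2) \<le> (norm (A (P s)))\<^sup>2"
        unfolding a_def by (rule sum_norm_square_le)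
      also have "\<dots> \<le> (norm A * norm (P s))\<^sup>2"
        by (intro power_mono norm_blinfun) simp
      finally show "(\<Sum>m<M. (a s m)\<^sup>2) \<le> (norm A)\<^sup>2 * (norm (P s))\<^sup>2"
        by (simp add: power_mult_distrib)
    qed simp
    also have "\<dots> = (1 / real N) * (norm A)\<^sup>2 * (\<Sum>s<M + N. (norm (P s))\<^sup>2)"
      by (simp add: sum_distrib_left)
    also have "\<dots> \<le> (1 / real N) * (norm A)\<^sup>2 * (real N * (norm x)\<^sup>2)"
    proof (rule mult_left_mono)
      \<comment> \<open>Double counting: each position \<open>j\<close> lies in the \<open>N\<close>
        windows \<open>j \<le> s < j + N\<close>, and this factor \<open>N\<close> cancels the
        weight \<open>1 / N\<close>.\<close>
      have "(\<Sum>s<M + N. (norm (P s))\<^sup>2)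
          \<le> (\<Sum>s<M + N. \<Sum>j<M + N. if j \<le> s \<and> s < j + N then (norm (ell2_nth x j))\<^sup>2 else 0)"
      proof (rule sum_mono)
        fix s assume "s \<in> {..<M + N}"
        then have W: "{..<M + N} \<inter> {j. j \<le> s \<and> s < j + N} = {j. j \<le> s \<and> s < j + N}"
          by auto
        moreover have "finite {j. j \<le> s \<and> s < j + N}"
          by simp
        ultimately show "(norm (P s))\<^sup>2
            \<le> (\<Sum>j<M + N. if j \<le> s \<and> s < j + N then (norm (ell2_nth x j))\<^sup>2 else 0)"
          using norm_restrict_le[of "{j. j \<le> s \<and> s < j + N}" x]
          by (simp add: sum.If_cases P_def)
      qed
      also have "\<dots> = (\<Sum>j<M + N. \<Sum>s<M + N. if j \<le> s \<and> s < j + N then (norm (ell2_nth x j))\<^sup>2 else 0)"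
        by (rule sum.swap)
      also have "\<dots> \<le> (\<Sum>j<M + N. real N * (norm (ell2_nth x j))\<^sup>2)"
      proof (rule sum_mono)
        fix j
        have "card ({..<M + N} \<inter> {s. j \<le> s \<and> s < j + N}) \<le> card {j..<j + N}"
          by (intro card_mono) auto
        then show "(\<Sum>s<M + N. if j \<le> s \<and> s < j + N then (norm (ell2_nth x j))\<^sup>2 else 0)
            \<le> real N * (norm (ell2_nth x j))\<^sup>2"
          by (simp add: sum.If_cases mult_right_mono)
      qed
      also have "\<dots> \<le> real N * (norm x)\<^sup>2"
        unfolding sum_distrib_left[symmetric] by (intro mult_left_mono sum_norm_square_le) simp
      finally show "(\<Sum>s<M + N. (norm (P s))\<^sup>2) \<le> real N * (norm x)\<^sup>2" .
    qed simp
    also have "\<dots> = (norm A * norm x)\<^sup>2"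
      using \<open>0 < N\<close> by (simp add: power_mult_distrib)
    finally show "(\<Sum>m<M. (norm (ell2_nth (S x) m))\<^sup>2) \<le> (norm A * norm x)\<^sup>2" .
  qed simp
qed simp

definition cesaro :: "(nat \<Rightarrow> 'a \<Rightarrow> complex) \<Rightarrow> nat \<Rightarrow> 'h ell2 \<Rightarrow>\<^sub>L 'h ell2" where
  "cesaro c N = (\<Sum>n<N. pi_mono \<rho> \<phi> n (\<lambda>x. complex_of_real (real (N - n) / real N) * c n x))"

text \<open>Truncated subtraction makes the weight zero for \<open>k \<ge> N\<close>, so one formula
  covers all indices of the finite sum.\<close>

lemma has_coeffs_cesaro:
  assumes "\<And>n. c n \<in> C0"
  shows "has_coeffs (cesaro c N) (\<lambda>k x. complex_of_real (real (N - k) / real N) * c k x)"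
proof -
  have "(\<lambda>n. if n < N then (\<lambda>x. complex_of_real (real (N - n) / real N) * c n x) else (\<lambda>_. 0))
      = (\<lambda>k x. complex_of_real (real (N - k) / real N) * c k x)"
    by (auto simp: fun_eq_iff)
  then show ?thesis
    using has_coeffs_sum_pi_mono[of "\<lambda>n x. complex_of_real (real (N - n) / real N) * c n x" N]
    by (simp only: cesaro_def C0_scale[OF assms])
qed

lemma cesaro_weight_tendsto: "(\<lambda>N. real (N - n) / real N) \<longlonglongrightarrow> 1"
proof (rule Lim_transform_eventually)
  show "(\<lambda>N. 1 - real n / real N) \<longlonglongrightarrow> 1"
    using tendsto_diff[OF tendsto_const lim_const_over_n[of "real n"], of 1] by simp
  show "\<forall>\<^sub>F N in sequentially. 1 - real n / real N = real (N - n) / real N"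
    using eventually_gt_at_top[of n]
    by (rule eventually_mono) (simp add: of_nat_diff diff_divide_distrib)
qed

text \<open>Taking means is contractive uniformly in \<open>N\<close>, and finite sums of monomials
  are dense. On such a sum the means converge because each weight tends to 1.\<close>

lemma cesaro_tendsto:
  assumes A: "A \<in> semicrossed_product \<rho> \<phi>" and c: "has_coeffs A c"
  shows "cesaro c \<longlonglongrightarrow> A"
proof (rule metric_LIMSEQ_I)
  fix e :: real
  assume "0 < e"
  obtain F where F: "\<And>j. F j \<in> l1_C0" "(\<lambda>j. pi_rep \<rho> \<phi> (F j)) \<longlonglongrightarrow> A"
    using semicrossed_product_sequence[OF A] by blast
  obtain j where j: "dist (pi_rep \<rho> \<phi> (F j)) A < e / 6"
    using metric_LIMSEQ_D[OF F(2), of "e / 6"] \<open>0 < e\<close> by auto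
  define f where "f = F j"
  have f: "\<And>n. f n \<in> C0"
    using F(1)[of j] by (simp add: f_def l1_C0_def)
  obtain M where M: "dist (\<Sum>n<M. pi_mono \<rho> \<phi> n (f n)) (pi_rep \<rho> \<phi> (F j)) < e / 6"
    using metric_LIMSEQ_D[OF pi_rep_sums[OF F(1)[of j], unfolded sums_def], of "e / 6"] \<open>0 < e\<close>
    by (auto simp: f_def)
  define B where "B = (\<Sum>n<M. pi_mono \<rho> \<phi> n (f n))"
  have B: "norm (A - B) < e / 3"
    using dist_triangle_lt[of B "pi_rep \<rho> \<phi> (F j)" A "e / 3"] M j
    by (simp add: B_def dist_norm norm_minus_commute)
  \<comment> \<open>\<open>T N\<close> is the \<open>N\<close>-th mean of \<open>B\<close>, written
    with the fixed number \<open>M\<close> of summands so that the limit can be taken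
    termwise.\<close>
  define T where "T N = (\<Sum>n<M. pi_mono \<rho> \<phi> n (\<lambda>x. complex_of_real (real (N - n) / real N) * f n x))" for N
  have T: "has_coeffs (T N) (\<lambda>k x. complex_of_real (real (N - k) / real N)
      * (if k < M then f k else (\<lambda>_. 0)) x)" for N
  proof -
    have "(\<lambda>n. if n < M then (\<lambda>x. complex_of_real (real (N - n) / real N) * f n x) else (\<lambda>_. 0))
      = (\<lambda>k x. complex_of_real (real (N - k) / real N) * (if k < M then f k else (\<lambda>_. 0)) x)"
      by (auto simp: fun_eq_iff)
    then show ?thesis
      using has_coeffs_sum_pi_mono[of "\<lambda>n x. complex_of_real (real (N - n) / real N) * f n x" M]
      by (simp only: T_def C0_scale[OF f])
  qed
  have "T \<longlonglongrightarrow> (\<Sum>n<M. 1 *\<^sub>R pi_mono \<rho> \<phi> n (f n))"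
    unfolding T_def pi_mono_scaleR[OF f]
    by (intro tendsto_sum tendsto_scaleR cesaro_weight_tendsto tendsto_const)
  then have "T \<longlonglongrightarrow> B"
    by (simp add: B_def)
  then obtain L where L: "\<And>N. L \<le> N \<Longrightarrow> norm (T N - B) < e / 3"
    using metric_LIMSEQ_D[of T B "e / 3"] \<open>0 < e\<close> by (auto simp: dist_norm)
  have "dist (cesaro c N) A < e" if "max L 1 \<le> N" for N
  proof -
    \<comment> \<open>The difference of the means is the \<open>N\<close>-th mean of
      \<open>A - B\<close>.\<close>
    have "norm (cesaro c N - T N) \<le> norm (A - B)"
    proof (rule norm_cesaro_le)
      show "has_coeffs (A - B) (\<lambda>k x. c k x - (if k < M then f k else (\<lambda>_. 0)) x)"
        unfolding B_def by (rule has_coeffs_diff[OF c has_coeffs_sum_pi_mono[OF f]])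
      show "has_coeffs (cesaro c N - T N) (\<lambda>k x. complex_of_real (real (N - k) / real N)
          * (c k x - (if k < M then f k else (\<lambda>_. 0)) x))"
        unfolding right_diff_distrib by (rule has_coeffs_diff[OF has_coeffs_cesaro T]) (rule has_coeffs_C0[OF c])
    qed (use that in simp)
    moreover have eq: "cesaro c N - A = (cesaro c N - T N) + (T N - B) + (B - A)"
      by simp
    have "norm (cesaro c N - A) \<le> norm (cesaro c N - T N) + norm (T N - B) + norm (B - A)"
      unfolding eq by (rule order_trans[OF norm_triangle_ineq add_right_mono[OF norm_triangle_ineq]])
    ultimately show ?thesis
      using B L[of N] that by (simp add: dist_norm norm_minus_commute)
  qed
  then show "\<exists>M. \<forall>N\<ge>M. dist (cesaro c N) A < e"
    by blast
qed

section \<open>Approximate units\<close>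

lemma pi_mono_in_semicrossed_product:
  assumes f: "f \<in> C0"
  shows "pi_mono \<rho> \<phi> n f \<in> semicrossed_product \<rho> \<phi>"
proof -
  let ?c = "\<lambda>k. if k = n then f else (\<lambda>_. 0)"
  have c: "\<And>k. ?c k \<in> C0"
    using f by (simp add: C0_zero)
  have "(\<lambda>k. if k < Suc n then ?c k else (\<lambda>_. 0)) = ?c"
    by auto
  then have "has_coeffs (\<Sum>k<Suc n. pi_mono \<rho> \<phi> k (?c k)) ?c"
    using has_coeffs_sum_pi_mono[of ?c "Suc n", OF c] by (simp only:)
  from has_coeffs_unique_op[OF has_coeffs_pi_mono[OF f] this] show ?thesis
    using sum_pi_mono_in_semicrossed_product[of ?c "Suc n", OF c] by (simp only:)
qed

lemma fourier_coeff_pi_mono: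
  assumes "f \<in> C0"
  shows "fourier_coeff \<rho> \<phi> k (pi_mono \<rho> \<phi> n f) = (if k = n then f else (\<lambda>_. 0))"
  by (rule fun_cong[OF has_coeffs_unique[OF
        has_coeffs_fourier_coeff[OF pi_mono_in_semicrossed_product[OF assms]] has_coeffs_pi_mono[OF assms]]])

lemma pi_mono_in_assoc_ideal:
  assumes "f \<in> C0" "\<And>x. x \<in> X n \<Longrightarrow> f x = 0"
  shows "pi_mono \<rho> \<phi> n f \<in> assoc_ideal \<rho> \<phi> X"
  using assms by (simp add: assoc_ideal_def pi_mono_in_semicrossed_product fourier_coeff_pi_mono)

lemma zero_in_assoc_ideal: "0 \<in> assoc_ideal \<rho> \<phi> X"
proof -
  have "pi_mono \<rho> \<phi> 0 (\<lambda>_. 0) = 0"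
    using pi_mono_scaleR[OF C0_zero, of 0 0] by simp
  then show ?thesis
    using pi_mono_in_assoc_ideal[OF C0_zero, of X 0] by simp
qed

lemma lowest_fourier_coeff:
  assumes A: "A \<in> semicrossed_product \<rho> \<phi>" and "A \<noteq> 0"
  obtains n y where "\<And>i. i < n \<Longrightarrow> fourier_coeff \<rho> \<phi> i A = (\<lambda>_. 0)" "fourier_coeff \<rho> \<phi> n A y \<noteq> 0"
proof -
  have "\<exists>n. fourier_coeff \<rho> \<phi> n A \<noteq> (\<lambda>_. 0)"
  proof (rule ccontr)
    assume "\<not> ?thesis"
    then have "has_coeffs A (\<lambda>_ _. 0)"
      using has_coeffs_fourier_coeff[OF A] by simp
    then show False
      using has_coeffs_unique_op[OF _ has_coeffs_zero] \<open>A \<noteq> 0\<close> by blast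
  qed
  from exists_least_iff[THEN iffD1, OF this] obtain n where
    n: "fourier_coeff \<rho> \<phi> n A \<noteq> (\<lambda>_. 0)" "\<And>i. i < n \<Longrightarrow> fourier_coeff \<rho> \<phi> i A = (\<lambda>_. 0)"
    by blast
  then obtain y where "fourier_coeff \<rho> \<phi> n A y \<noteq> 0"
    by (auto simp: fun_eq_iff)
  then show ?thesis
    using that n(2) by blast
qed

text \<open>If \<open>A = U\<^sup>n f + \<dots>\<close> has lowest term \<open>U\<^sup>n f\<close>, then \<open>uA\<close> has lowest term
  \<open>U\<^sup>n ((E\<^sub>0 u \<circ> \<phi>\<^sup>n) f)\<close>.\<close>

lemma left_approximate_unit_lowest_coeff:
  assumes unit: "has_left_approximate_unit (assoc_ideal \<rho> \<phi> X)"
    and A: "A \<in> assoc_ideal \<rho> \<phi> X"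
    and low: "\<And>i. i < n \<Longrightarrow> fourier_coeff \<rho> \<phi> i A = (\<lambda>_. 0)"
    and y: "fourier_coeff \<rho> \<phi> n A y \<noteq> 0"
  shows "(\<phi> ^^ n) y \<notin> X 0"
proof
  assume "(\<phi> ^^ n) y \<in> X 0"
  define c where "c k = fourier_coeff \<rho> \<phi> k A" for k
  have c: "has_coeffs A c"
    unfolding c_def using A by (intro has_coeffs_fourier_coeff) (simp add: assoc_ideal_def)
  \<comment> \<open>One member of the net suffices. The tolerance is the value that the error must
    reach at \<open>y\<close> if \<open>E_0(u)\<close> vanishes at
    \<open>(\<phi> ^^ n) y\<close>.\<close>
  obtain u where u: "u \<in> assoc_ideal \<rho> \<phi> X" "dist (u o\<^sub>L A) A < cmod (c n y)"
  proof -
    obtain \<Lambda> :: "(('h ell2 \<Rightarrow>\<^sub>L 'h ell2) set \<times> ('h ell2 \<Rightarrow>\<^sub>L 'h ell2)) set" and le v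
      where "left_approximate_unit (assoc_ideal \<rho> \<phi> X) \<Lambda> le v"
      using unit unfolding has_left_approximate_unit_def by blast
    then have v: "\<And>i. i \<in> \<Lambda> \<Longrightarrow> v i \<in> assoc_ideal \<rho> \<phi> X" "\<And>i. i \<in> \<Lambda> \<Longrightarrow> le i i"
        "net_tendsto \<Lambda> le (\<lambda>i. v i o\<^sub>L A) A"
      using A by (auto simp: left_approximate_unit_def directed_preorder_def)
    moreover have "0 < cmod (c n y)"
      using y by (simp add: c_def)
    ultimately obtain i where "i \<in> \<Lambda>" "dist (v i o\<^sub>L A) A < cmod (c n y)"
      unfolding net_tendsto_def by blast
    then show ?thesis
      using v(1) that by blast
  qed
  define d where "d k = fourier_coeff \<rho> \<phi> k u" for k
  have d: "has_coeffs u d"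
    unfolding d_def using u(1) by (intro has_coeffs_fourier_coeff) (simp add: assoc_ideal_def)
  have C: "c n \<in> C0" and DC: "(\<lambda>x. d 0 ((\<phi> ^^ n) x) * c n x) \<in> C0"
    using has_coeffs_C0[OF c] C0_mult[OF C0_funpow[OF has_coeffs_C0[OF d]] has_coeffs_C0[OF c], of 0 n n]
    by (simp_all add: comp_def)
  have "ell2_nth (blinfun_apply (A - (u o\<^sub>L A)) (ell2_single \<xi>)) n
      = \<rho> (\<lambda>x. c n x - d 0 ((\<phi> ^^ n) x) * c n x) \<xi>" for \<xi>
  proof -
    have "ell2_nth (u (A (ell2_single \<xi>))) n = (\<Sum>j\<le>n. \<rho> (d (n - j) \<circ> \<phi> ^^ j) (\<rho> (c j) \<xi>))"
      unfolding has_coeffs_nth[OF d] ell2_nth_apply_single[OF c] ..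
    \<comment> \<open>The coefficients of \<open>A\<close> below \<open>n\<close> vanish, so only
      \<open>j = n\<close> survives, paired with \<open>d 0\<close>.\<close>
    also have "\<dots> = (\<Sum>j\<le>n. if j = n then \<rho> (d (n - j) \<circ> \<phi> ^^ j) (\<rho> (c j) \<xi>) else 0)"
      by (intro sum.cong) (auto simp: c_def low rep_zero[OF rep])
    also have "\<dots> = \<rho> (\<lambda>x. d 0 ((\<phi> ^^ n) x) * c n x) \<xi>"
      using rep_mult[OF rep C0_funpow[OF has_coeffs_C0[OF d]] C, of 0 n] by (simp add: comp_def)
    finally show ?thesis
      by (simp add: blinfun.diff_left minus_ell2.rep_eq rep_diff[OF rep C DC] ell2_nth_apply_single[OF c])
  qed
  then have "cmod (c n y - d 0 ((\<phi> ^^ n) y) * c n y) \<le> norm (A - (u o\<^sub>L A))"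
    by (rule norm_le_if_entries[OF C0_diff[OF C DC]])
  moreover have "d 0 ((\<phi> ^^ n) y) = 0"
    using u(1) \<open>(\<phi> ^^ n) y \<in> X 0\<close> by (simp add: d_def assoc_ideal_def)
  ultimately show False
    using u(2) by (simp add: dist_norm norm_minus_commute)
qed

end

section \<open>Nets of left multipliers\<close>

lemma net_tendsto_add:
  fixes u v :: "'i \<Rightarrow> 'b::real_normed_vector"
  assumes dir: "directed_preorder \<Lambda> le"
    and u: "net_tendsto \<Lambda> le u a" and v: "net_tendsto \<Lambda> le v b"
  shows "net_tendsto \<Lambda> le (\<lambda>i. u i + v i) (a + b)"
  unfolding net_tendsto_def
proof (intro allI impI)
  fix e :: real
  assume "0 < e"
  obtain i where i: "i \<in> \<Lambda>" "\<And>k. k \<in> \<Lambda> \<Longrightarrow> le i k \<Longrightarrow> dist (u k) a < e / 2"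
    using u \<open>0 < e\<close> unfolding net_tendsto_def by (meson half_gt_zero)
  obtain j where j: "j \<in> \<Lambda>" "\<And>k. k \<in> \<Lambda> \<Longrightarrow> le j k \<Longrightarrow> dist (v k) b < e / 2"
    using v \<open>0 < e\<close> unfolding net_tendsto_def by (meson half_gt_zero)
  obtain k where k: "k \<in> \<Lambda>" "le i k" "le j k"
    using dir i(1) j(1) unfolding directed_preorder_def by blast
  have "dist (u l + v l) (a + b) < e" if "l \<in> \<Lambda>" "le k l" for l
  proof -
    have "le i l" "le j l"
      using dir i(1) j(1) k that unfolding directed_preorder_def by blast+
    then show ?thesis
      using i(2) j(2) that(1) dist_triangle_add[of "u l" "v l" a b] by fastforce
  qed
  then show "\<exists>i\<in>\<Lambda>. \<forall>j\<in>\<Lambda>. le i j \<longrightarrow> dist (u j + v j) (a + b) < e"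
    using k(1) by blast
qed

lemma net_tendsto_sum_compose:
  fixes B :: "nat \<Rightarrow> 'b::real_normed_vector \<Rightarrow>\<^sub>L 'b"
  assumes dir: "directed_preorder \<Lambda> le"
    and B: "\<And>n. net_tendsto \<Lambda> le (\<lambda>i. u i o\<^sub>L B n) (B n)"
  shows "net_tendsto \<Lambda> le (\<lambda>i. u i o\<^sub>L (\<Sum>n<N. B n)) (\<Sum>n<N. B n)"
proof (induction N)
  case 0
  have "\<Lambda> \<noteq> {}"
    using dir by (simp add: directed_preorder_def)
  then show ?case
    by (auto simp: net_tendsto_def)
next
  case (Suc N)
  have "(\<lambda>i. u i o\<^sub>L (\<Sum>n<Suc N. B n)) = (\<lambda>i. (u i o\<^sub>L (\<Sum>n<N. B n)) + (u i o\<^sub>L B N))"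
    by (intro ext blinfun_eqI) (simp add: blinfun.add_left blinfun.add_right)
  then show ?case
    using net_tendsto_add[OF dir Suc B[of N]] by simp
qed

text \<open>The net is uniformly bounded, so the operators on which it acts as a left unit form a
  norm closed set.\<close>

lemma net_tendsto_compose_limit:
  fixes A :: "'b::real_normed_vector \<Rightarrow>\<^sub>L 'b"
  assumes bound: "\<And>i. i \<in> \<Lambda> \<Longrightarrow> norm (u i) \<le> 1"
    and B: "\<And>n. net_tendsto \<Lambda> le (\<lambda>i. u i o\<^sub>L B n) (B n)" and lim: "B \<longlonglongrightarrow> A"
  shows "net_tendsto \<Lambda> le (\<lambda>i. u i o\<^sub>L A) A"
  unfolding net_tendsto_def
proof (intro allI impI)
  fix e :: real
  assume "0 < e"
  then obtain n where n: "norm (B n - A) < e / 3"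
    using metric_LIMSEQ_D[OF lim, of "e / 3"] by (auto simp: dist_norm)
  obtain i where i: "i \<in> \<Lambda>" "\<And>j. j \<in> \<Lambda> \<Longrightarrow> le i j \<Longrightarrow> dist (u j o\<^sub>L B n) (B n) < e / 3"
    using B[of n] \<open>0 < e\<close> unfolding net_tendsto_def by (metis divide_pos_pos zero_less_numeral)
  have "dist (u j o\<^sub>L A) A < e" if j: "j \<in> \<Lambda>" "le i j" for j
  proof -
    have "norm (u j o\<^sub>L (A - B n)) \<le> norm (u j) * norm (A - B n)"
      by (rule norm_blinfun_compose)
    also have "\<dots> \<le> 1 * norm (A - B n)"
      by (intro mult_right_mono bound j) simp
    finally have 1: "norm (u j o\<^sub>L (A - B n)) \<le> norm (B n - A)"
      by (simp add: norm_minus_commute)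
    have eq: "(u j o\<^sub>L A) - A = (u j o\<^sub>L (A - B n)) + ((u j o\<^sub>L B n) - B n) + (B n - A)"
      by (intro blinfun_eqI) (simp add: blinfun.add_left blinfun.diff_left blinfun.diff_right)
    have "norm ((u j o\<^sub>L A) - A)
        \<le> norm (u j o\<^sub>L (A - B n)) + norm ((u j o\<^sub>L B n) - B n) + norm (B n - A)"
      unfolding eq by (rule order_trans[OF norm_triangle_ineq add_right_mono[OF norm_triangle_ineq]])
    then show ?thesis
      using 1 n i(2)[OF j] by (simp add: dist_norm)
  qed
  then show "\<exists>i\<in>\<Lambda>. \<forall>j\<in>\<Lambda>. le i j \<longrightarrow> dist (u j o\<^sub>L A) A < e"
    using i(1) by blast
qed

lemma (in proper_dynamics) has_left_approximate_unit_assoc_ideal: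
  assumes lc: "locally_compact_space (euclidean :: 'a topology)"
    and closed: "closed (X 0)" and sub: "\<And>n. (\<phi> ^^ n) ` (- X n) \<subseteq> - X 0"
  shows "has_left_approximate_unit (assoc_ideal \<rho> \<phi> X)"
proof -
  define \<Lambda> where "\<Lambda> = {K. compact K \<and> K \<subseteq> - X 0}"
  have "\<exists>f. f \<in> C0 \<and> (\<forall>x\<in>K. f x = 1) \<and> (\<forall>x\<in>X 0. f x = 0) \<and> (\<forall>x. cmod (f x) \<le> 1)
      \<and> (\<forall>x. cmod (1 - f x) \<le> 1)" if "K \<in> \<Lambda>" for K
  proof -
    have "compact K" "K \<subseteq> - X 0"
      using that by (simp_all add: \<Lambda>_def)
    then show ?thesis
      by (rule locally_compact_Urysohn[OF lc _ open_Compl[OF closed]]) auto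
  qed
  then have "\<forall>K\<in>\<Lambda>. \<exists>f. f \<in> C0 \<and> (\<forall>x\<in>K. f x = 1) \<and> (\<forall>x\<in>X 0. f x = 0) \<and> (\<forall>x. cmod (f x) \<le> 1)
      \<and> (\<forall>x. cmod (1 - f x) \<le> 1)" ..
  from bchoice[OF this] obtain h where
    "\<forall>K\<in>\<Lambda>. h K \<in> C0 \<and> (\<forall>x\<in>K. h K x = 1) \<and> (\<forall>x\<in>X 0. h K x = 0) \<and> (\<forall>x. cmod (h K x) \<le> 1)
      \<and> (\<forall>x. cmod (1 - h K x) \<le> 1)" ..
  then have h: "h K \<in> C0" "\<And>x. x \<in> K \<Longrightarrow> h K x = 1" "\<And>x. x \<in> X 0 \<Longrightarrow> h K x = 0"
    "\<And>x. cmod (h K x) \<le> 1" "\<And>x. cmod (1 - h K x) \<le> 1" if "K \<in> \<Lambda>" for K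
    using that by auto
  define u where "u K = pi_mono \<rho> \<phi> 0 (h K)" for K
  have dir: "directed_preorder \<Lambda> (\<subseteq>)"
    unfolding directed_preorder_def
  proof (intro conjI ballI impI)
    have "{} \<in> \<Lambda>"
      by (simp add: \<Lambda>_def)
    then show "\<Lambda> \<noteq> {}"
      by auto
    fix K L assume "K \<in> \<Lambda>" "L \<in> \<Lambda>"
    then have "K \<union> L \<in> \<Lambda>"
      by (simp add: \<Lambda>_def compact_Un)
    then show "\<exists>M\<in>\<Lambda>. K \<subseteq> M \<and> L \<subseteq> M"
      by auto
  qed auto
  have bound: "norm (u K) \<le> 1" if "K \<in> \<Lambda>" for K
    unfolding u_def by (intro order_trans[OF norm_pi_mono_le] sup_norm_le h that)
  have mono: "net_tendsto \<Lambda> (\<subseteq>) (\<lambda>K. u K o\<^sub>L pi_mono \<rho> \<phi> n f) (pi_mono \<rho> \<phi> n f)"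
    if f: "f \<in> C0" "\<And>x. x \<in> X n \<Longrightarrow> f x = 0" for n f
    unfolding net_tendsto_def
  proof (intro allI impI)
    fix e :: real
    assume "0 < e"
    \<comment> \<open>Once \<open>K\<close> contains this compact set, \<open>h K\<close> composed
      with \<open>\<phi> ^^ n\<close> is 1 wherever \<open>f\<close> is not small; elsewhere the
      bound on \<open>1 - h K\<close> suffices.\<close>
    define K0 where "K0 = (\<phi> ^^ n) ` {x. e / 2 \<le> cmod (f x)}"
    have "compact K0"
      unfolding K0_def using C0_compact[OF f(1), of "e / 2"] \<open>0 < e\<close>
      by (intro compact_continuous_image continuous_on_subset[OF continuous_funpow]) auto
    moreover have "{x. e / 2 \<le> cmod (f x)} \<subseteq> - X n"
      using f(2) \<open>0 < e\<close> by force
    then have "K0 \<subseteq> - X 0"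
      unfolding K0_def using sub[of n] by blast
    ultimately have K0: "K0 \<in> \<Lambda>"
      by (simp add: \<Lambda>_def)
    have "dist (u K o\<^sub>L pi_mono \<rho> \<phi> n f) (pi_mono \<rho> \<phi> n f) < e" if K: "K \<in> \<Lambda>" "K0 \<subseteq> K" for K
    proof -
      have g: "(\<lambda>x. h K ((\<phi> ^^ n) x) * f x) \<in> C0"
        using C0_mult[OF C0_funpow[OF h(1)[OF K(1)]] f(1)] by (simp add: comp_def)
      have "cmod (h K ((\<phi> ^^ n) x) * f x - f x) \<le> e / 2" for x
      proof (cases "e / 2 \<le> cmod (f x)")
        case True
        then have "(\<phi> ^^ n) x \<in> K"
          using K(2) by (auto simp: K0_def)
        then show ?thesis
          using h(2)[OF K(1)] \<open>0 < e\<close> by simp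
      next
        case False
        have "cmod (h K ((\<phi> ^^ n) x) * f x - f x) = cmod (1 - h K ((\<phi> ^^ n) x)) * cmod (f x)"
          by (simp add: norm_mult[symmetric] left_diff_distrib norm_minus_commute)
        also have "\<dots> \<le> 1 * cmod (f x)"
          by (intro mult_right_mono h(5)[OF K(1)]) simp
        finally show ?thesis
          using False by simp
      qed
      then have "sup_norm (\<lambda>x. h K ((\<phi> ^^ n) x) * f x - f x) \<le> e / 2"
        by (rule sup_norm_le)
      moreover have "(u K o\<^sub>L pi_mono \<rho> \<phi> n f) - pi_mono \<rho> \<phi> n f
          = pi_mono \<rho> \<phi> n (\<lambda>x. h K ((\<phi> ^^ n) x) * f x - f x)"
        by (simp add: u_def pi_mono_compose[OF h(1)[OF K(1)] f(1)] pi_mono_diff[OF g f(1)])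
      ultimately show ?thesis
        using norm_pi_mono_le[OF C0_diff[OF g f(1)], of n] \<open>0 < e\<close> by (simp add: dist_norm)
    qed
    then show "\<exists>K\<in>\<Lambda>. \<forall>L\<in>\<Lambda>. K \<subseteq> L \<longrightarrow> dist (u L o\<^sub>L pi_mono \<rho> \<phi> n f) (pi_mono \<rho> \<phi> n f) < e"
      using K0 by blast
  qed
  have "net_tendsto \<Lambda> (\<subseteq>) (\<lambda>K. u K o\<^sub>L A) A" if A: "A \<in> assoc_ideal \<rho> \<phi> X" for A
  proof (rule net_tendsto_compose_limit[OF bound])
    define c where "c n = fourier_coeff \<rho> \<phi> n A" for n
    have A': "A \<in> semicrossed_product \<rho> \<phi>" and zero: "\<And>n x. x \<in> X n \<Longrightarrow> c n x = 0"
      using A by (simp_all add: assoc_ideal_def c_def)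
    then have c: "has_coeffs A c"
      unfolding c_def by (intro has_coeffs_fourier_coeff)
    show "cesaro c \<longlonglongrightarrow> A"
      by (rule cesaro_tendsto[OF A' c])
    show "net_tendsto \<Lambda> (\<subseteq>) (\<lambda>K. u K o\<^sub>L cesaro c N) (cesaro c N)" for N
      unfolding cesaro_def
      by (intro net_tendsto_sum_compose[OF dir] mono C0_scale has_coeffs_C0[OF c]) (simp add: zero)
  qed
  moreover have "u K \<in> assoc_ideal \<rho> \<phi> X" if "K \<in> \<Lambda>" for K
    unfolding u_def by (intro pi_mono_in_assoc_ideal h that)
  ultimately have "left_approximate_unit (assoc_ideal \<rho> \<phi> X) \<Lambda> (\<subseteq>) u"
    unfolding left_approximate_unit_def using dir bound zero_less_one by blast
  then show ?thesis
    by (rule left_approximate_unit_imp_has)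
qed

section \<open>Orbits and the complements of the sets \<open>X n\<close>\<close>

lemma funpow_mem_first:
  assumes "\<And>n. \<phi> ` X (Suc n) \<subseteq> X n"
  shows "x \<in> X n \<Longrightarrow> (\<phi> ^^ n) x \<in> X 0"
proof (induction n arbitrary: x)
  case (Suc n)
  then have "(\<phi> ^^ n) (\<phi> x) \<in> X 0"
    using assms[of n] by blast
  then show ?case
    by (simp only: funpow_Suc_right comp_apply)
qed simp

text \<open>Under the first condition \<open>x \<in> X n\<close> holds exactly when
  \<open>(\<phi> ^^ n) x \<in> X 0\<close>, so \<open>X (Suc n)\<close> is the full preimage of
  \<open>X n\<close> and differences go onto differences. Conversely complements are built up from
  differences. If every \<open>X n\<close> were the whole space, the second condition would hold and
  the first would fail; hence \<open>nontrivial\<close>.\<close>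

lemma image_complement_iff_image_differences:
  assumes surj: "surj \<phi>" and dec: "\<And>n. X (Suc n) \<union> \<phi> ` X (Suc n) \<subseteq> X n"
    and nontrivial: "X k \<noteq> UNIV"
  shows "X 0 \<subset> UNIV \<and> (\<forall>n. (\<phi> ^^ n) ` (UNIV - X n) = UNIV - X 0)
      \<longleftrightarrow> \<phi> ` (UNIV - X 1) = UNIV - X 0 \<and> (\<forall>n. \<phi> ` (X (Suc n) - X (Suc (Suc n))) = X n - X (Suc n))"
    (is "?L \<longleftrightarrow> ?R")
proof
  assume L: ?L
  then have out: "(\<phi> ^^ n) x \<notin> X 0" if "x \<notin> X n" for n x
    using that by blast
  have first: "(\<phi> ^^ n) x \<in> X 0" if "x \<in> X n" for n x
    by (rule funpow_mem_first[of \<phi> X, OF _ that]) (use dec in blast)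
  have "\<phi> ` (X (Suc n) - X (Suc (Suc n))) = X n - X (Suc n)" for n
  proof (intro equalityI subsetI)
    fix y assume "y \<in> \<phi> ` (X (Suc n) - X (Suc (Suc n)))"
    then obtain x where x: "x \<in> X (Suc n)" "x \<notin> X (Suc (Suc n))" "y = \<phi> x"
      by blast
    have "(\<phi> ^^ Suc n) y \<notin> X 0"
      using out[OF x(2)] unfolding x(3) by (simp only: funpow_Suc_right comp_apply not_False_eq_True)
    then show "y \<in> X n - X (Suc n)"
      using first[of y "Suc n"] x dec[of n] by blast
  next
    fix y assume y: "y \<in> X n - X (Suc n)"
    obtain x where x: "y = \<phi> x"
      using surj by blast
    have "x \<notin> X (Suc (Suc n))"
      using y x dec[of "Suc n"] by blast
    moreover have "x \<in> X (Suc n)"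
    proof (rule ccontr)
      assume "x \<notin> X (Suc n)"
      then have "(\<phi> ^^ n) y \<notin> X 0"
        using out[of x "Suc n"] unfolding x by (simp only: funpow_Suc_right comp_apply not_False_eq_True)
      then show False
        using first[of y n] y by blast
    qed
    ultimately show "y \<in> \<phi> ` (X (Suc n) - X (Suc (Suc n)))"
      using x by blast
  qed
  moreover have "(\<phi> ^^ 1) ` (UNIV - X 1) = UNIV - X 0"
    using L by blast
  ultimately show ?R
    by simp
next
  assume R: ?R
  have "X 0 \<noteq> UNIV"
  proof
    assume "X 0 = UNIV"
    \<comment> \<open>Two consecutive sets are carried along because each equation of the second
      condition links three of them.\<close>
    have "X n = UNIV \<and> X (Suc n) = UNIV" for n
    proof (induction n)
      case 0
      then show ?case
        using R \<open>X 0 = UNIV\<close> by auto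
    next
      case (Suc n)
      moreover have "\<phi> ` (X (Suc n) - X (Suc (Suc n))) = X n - X (Suc n)"
        using R by blast
      ultimately show ?case
        by auto
    qed
    then show False
      using nontrivial by blast
  qed
  have step: "\<phi> ` (UNIV - X (Suc n)) = UNIV - X n" for n
  proof (induction n)
    case 0
    then show ?case
      using R by simp
  next
    case (Suc n)
    have "UNIV - X (Suc (Suc n)) = (UNIV - X (Suc n)) \<union> (X (Suc n) - X (Suc (Suc n)))"
      using dec[of "Suc n"] by blast
    then have "\<phi> ` (UNIV - X (Suc (Suc n))) = (UNIV - X n) \<union> (X n - X (Suc n))"
      using R Suc by (simp only: image_Un)
    then show ?case
      using dec[of n] by blast
  qed
  have "(\<phi> ^^ n) ` (UNIV - X n) = UNIV - X 0" for n
  proof (induction n)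
    case (Suc n)
    have "(\<phi> ^^ Suc n) ` (UNIV - X (Suc n)) = (\<phi> ^^ n) ` \<phi> ` (UNIV - X (Suc n))"
      by (simp only: funpow_Suc_right image_comp)
    then show ?case
      using Suc step by simp
  qed simp
  then show ?L
    using \<open>X 0 \<noteq> UNIV\<close> by blast
qed

theorem theorem2p2:
  fixes \<phi> :: "'a::t2_space \<Rightarrow> 'a"
    and \<rho> :: "('a \<Rightarrow> complex) \<Rightarrow> 'h::chilbert_space \<Rightarrow>\<^sub>L 'h"
    and X :: "nat \<Rightarrow> 'a set"
  assumes "locally_compact_space (euclidean :: 'a topology)"
    and "continuous_on UNIV \<phi>"
    and "\<And>K. compact K \<Longrightarrow> compact (\<phi> -` K)"
    and "surj \<phi>"
    and "faithful_star_rep \<rho>"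
    and "\<And>n. closed (X n)"
    and "\<And>n. X (Suc n) \<union> \<phi> ` X (Suc n) \<subseteq> X n"
    and "assoc_ideal \<rho> \<phi> X \<noteq> {0}"
  shows "(has_left_approximate_unit (assoc_ideal \<rho> \<phi> X)
            \<longleftrightarrow> X 0 \<subset> UNIV \<and> (\<forall>n. (\<phi> ^^ n) ` (UNIV - X n) = UNIV - X 0))
       \<and> (X 0 \<subset> UNIV \<and> (\<forall>n. (\<phi> ^^ n) ` (UNIV - X n) = UNIV - X 0)
            \<longleftrightarrow> \<phi> ` (UNIV - X 1) = UNIV - X 0
                \<and> (\<forall>n. \<phi> ` (X (Suc n) - X (Suc (Suc n))) = X n - X (Suc n)))"
proof -
  interpret proper_dynamics \<phi> \<rho>
    by unfold_locales (use assms in auto)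
  obtain A where A: "A \<in> assoc_ideal \<rho> \<phi> X" "A \<noteq> 0"
    using assms(8) zero_in_assoc_ideal[of X] by blast
  then have "A \<in> semicrossed_product \<rho> \<phi>"
    by (simp add: assoc_ideal_def)
  then obtain k y where low: "\<And>i. i < k \<Longrightarrow> fourier_coeff \<rho> \<phi> i A = (\<lambda>_. 0)"
    and y: "fourier_coeff \<rho> \<phi> k A y \<noteq> 0"
    using lowest_fourier_coeff[OF _ A(2)] by blast
  \<comment> \<open>The point \<open>y\<close> is used twice: it shows that \<open>X k\<close> is
    proper, and, given a left approximate unit, \<open>(\<phi> ^^ k) y\<close> lies outside
    \<open>X 0\<close>.\<close>
  have "y \<notin> X k"
    using A(1) y by (auto simp: assoc_ideal_def)
  have first: "(\<phi> ^^ n) x \<in> X 0" if "x \<in> X n" for n x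
    by (rule funpow_mem_first[of \<phi> X, OF _ that]) (use assms(7) in blast)
  have left_unit_imp: "X 0 \<subset> UNIV \<and> (\<forall>n. (\<phi> ^^ n) ` (UNIV - X n) = UNIV - X 0)"
    if unit: "has_left_approximate_unit (assoc_ideal \<rho> \<phi> X)"
  proof (intro conjI allI)
    show "X 0 \<subset> UNIV"
      using left_approximate_unit_lowest_coeff[OF unit A(1) low y] by blast
    fix n
    have "(\<phi> ^^ n) x \<notin> X 0" if "x \<notin> X n" for x
    proof -
      have "open (- X n)" "{x} \<subseteq> - X n"
        using assms(6) that by auto
      then obtain f where f: "f \<in> C0" "f x = 1" "\<And>z. z \<in> X n \<Longrightarrow> f z = 0"
        by (rule locally_compact_Urysohn[OF assms(1) compact_sing]) auto
      \<comment> \<open>The monomial U^n f has lowest coefficient \<open>f\<close>, which is 1 at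
        \<open>x\<close>, so the lowest coefficient criterion applies at \<open>x\<close>.\<close>
      have mem: "pi_mono \<rho> \<phi> n f \<in> assoc_ideal \<rho> \<phi> X"
        by (rule pi_mono_in_assoc_ideal[OF f(1,3)])
      then show ?thesis
        using f(2) by (intro left_approximate_unit_lowest_coeff[OF unit mem])
          (simp_all add: fourier_coeff_pi_mono[OF f(1)])
    qed
    \<comment> \<open>A preimage of \<open>z\<close> under the surjection \<open>\<phi> ^^ n\<close>
      cannot lie in \<open>X n\<close>, since \<open>X n\<close> is mapped into
      \<open>X 0\<close>.\<close>
    moreover have "\<exists>x. x \<notin> X n \<and> z = (\<phi> ^^ n) x" if "z \<notin> X 0" for z
      using surj_fn[OF assms(4), of n] first that by (metis surjD)
    ultimately show "(\<phi> ^^ n) ` (UNIV - X n) = UNIV - X 0"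
      by blast
  qed
  have imp_left_unit: "has_left_approximate_unit (assoc_ideal \<rho> \<phi> X)"
    if "X 0 \<subset> UNIV \<and> (\<forall>n. (\<phi> ^^ n) ` (UNIV - X n) = UNIV - X 0)"
    using that by (intro has_left_approximate_unit_assoc_ideal assms) (simp add: Compl_eq_Diff_UNIV)
  have images: "X 0 \<subset> UNIV \<and> (\<forall>n. (\<phi> ^^ n) ` (UNIV - X n) = UNIV - X 0)
      \<longleftrightarrow> \<phi> ` (UNIV - X 1) = UNIV - X 0 \<and> (\<forall>n. \<phi> ` (X (Suc n) - X (Suc (Suc n))) = X n - X (Suc n))"
    using \<open>y \<notin> X k\<close> by (intro image_complement_iff_image_differences[of \<phi> X k] assms) auto
  show ?thesis
    by (rule conjI[OF iffI[OF left_unit_imp imp_left_unit] images])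
qed

end
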